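(* Let $\mathbf{Bicat}(1)_1$ be the category whose objects are the degenerate bicategories (bicategories with exactly one 0-cell, denoted $\ast$) and whose morphisms are the weak functors between them, and let $\mathbf{MonCat}_1$ be the category of monoidal categories and (weak) monoidal functors. Then the obvious functor $\xi:\mathbf{Bicat}(1)_1\to\mathbf{MonCat}_1$, sending a degenerate bicategory to its unique hom-category $\mathcal{B}(\ast,\ast)$ with monoidal structure given by composition of 1-cells, and a weak functor to the corresponding monoidal functor, is an equivalence of categories.
   Context: A degenerate bicategory is a bicategory with only one 0-cell, by convention a fixed $\ast$. For such $\mathcal{B}$, the category $\mathcal{B}(\ast,\ast)$ of 1-cells and 2-cells is a monoidal category with tensor product given by horizontal composition, unit object $I_\ast$, and associativity and unit constraints those of $\mathcal{B}$. A weak functor is one whose constraint 2-cells $Fg\circ Ff\Rightarrow F(g\circ f)$ and $I_{Fa}\Rightarrow F(I_a)$ are invertible; between degenerate bicategories its action on the hom-category together with these constraints is a weak (i.e. strong) monoidal functor, one whose constraints $FA\otimes FB\to F(A\otimes B)$ and $I\to FI$ are isomorphisms. *)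

theory Defs
  imports "HOL-Library.FuncSet"
begin

section \<open>Categories, functors, equivalences\<close>

text \<open>
  All structures below are records of HOL functions restricted to carrier sets. Every operation
  is required to take the value \<^const>\<open>undefined\<close> outside its domain of definition,
  so that two structures are equal as HOL values exactly when they are equal as mathematical
  structures. Composition is written in applicative order: \<open>g \<cdot> f\<close> is ``first
  \<open>f\<close>, then \<open>g\<close>''.
\<close>

record ('o, 'm) cat =
  Obj :: "'o set"
  Arr :: "'m set"
  Dom :: "'m \<Rightarrow> 'o"
  Cod :: "'m \<Rightarrow> 'o"
  Idt :: "'o \<Rightarrow> 'm"
  Comp :: "'m \<Rightarrow> 'm \<Rightarrow> 'm" (infixr "\<cdot>\<index>" 70)

locale category =
  fixes C :: "('o, 'm) cat" (structure)
  assumes Dom_closed: "Dom C \<in> Arr C \<rightarrow>\<^sub>E Obj C"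
    and Cod_closed: "Cod C \<in> Arr C \<rightarrow>\<^sub>E Obj C"
    and Idt_closed: "Idt C \<in> Obj C \<rightarrow>\<^sub>E Arr C"
    and Dom_Idt: "x \<in> Obj C \<Longrightarrow> Dom C (Idt C x) = x"
    and Cod_Idt: "x \<in> Obj C \<Longrightarrow> Cod C (Idt C x) = x"
    and Comp_closed: "\<lbrakk>f \<in> Arr C; g \<in> Arr C; Dom C g = Cod C f\<rbrakk> \<Longrightarrow> g \<cdot> f \<in> Arr C"
    and Dom_Comp: "\<lbrakk>f \<in> Arr C; g \<in> Arr C; Dom C g = Cod C f\<rbrakk> \<Longrightarrow> Dom C (g \<cdot> f) = Dom C f"
    and Cod_Comp: "\<lbrakk>f \<in> Arr C; g \<in> Arr C; Dom C g = Cod C f\<rbrakk> \<Longrightarrow> Cod C (g \<cdot> f) = Cod C g"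
    and Comp_undefined:
      "\<not> (f \<in> Arr C \<and> g \<in> Arr C \<and> Dom C g = Cod C f) \<Longrightarrow> g \<cdot> f = undefined"
    and Comp_Idt_right: "f \<in> Arr C \<Longrightarrow> f \<cdot> Idt C (Dom C f) = f"
    and Comp_Idt_left: "f \<in> Arr C \<Longrightarrow> Idt C (Cod C f) \<cdot> f = f"
    and Comp_assoc:
      "\<lbrakk>f \<in> Arr C; g \<in> Arr C; h \<in> Arr C; Dom C g = Cod C f; Dom C h = Cod C g\<rbrakk>
        \<Longrightarrow> (h \<cdot> g) \<cdot> f = h \<cdot> (g \<cdot> f)"

definition hom :: "('o, 'm) cat \<Rightarrow> 'o \<Rightarrow> 'o \<Rightarrow> 'm set" where
  "hom C x y = {f \<in> Arr C. Dom C f = x \<and> Cod C f = y}"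

definition iso_hom :: "('o, 'm) cat \<Rightarrow> 'o \<Rightarrow> 'o \<Rightarrow> 'm set" where
  "iso_hom C x y =
    {f \<in> hom C x y. \<exists>g \<in> hom C y x. g \<cdot>\<^bsub>C\<^esub> f = Idt C x \<and> f \<cdot>\<^bsub>C\<^esub> g = Idt C y}"

definition prod_cat ::
  "('o, 'm) cat \<Rightarrow> ('p, 'n) cat \<Rightarrow> ('o \<times> 'p, 'm \<times> 'n) cat" where
  "prod_cat C D =
    \<lparr>Obj = Obj C \<times> Obj D,
     Arr = Arr C \<times> Arr D,
     Dom = (\<lambda>k \<in> Arr C \<times> Arr D. (Dom C (fst k), Dom D (snd k))),
     Cod = (\<lambda>k \<in> Arr C \<times> Arr D. (Cod C (fst k), Cod D (snd k))),
     Idt = (\<lambda>x \<in> Obj C \<times> Obj D. (Idt C (fst x), Idt D (snd x))),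
     Comp = (\<lambda>l k.
       if k \<in> Arr C \<times> Arr D \<and> l \<in> Arr C \<times> Arr D
          \<and> Dom C (fst l) = Cod C (fst k) \<and> Dom D (snd l) = Cod D (snd k)
       then (fst l \<cdot>\<^bsub>C\<^esub> fst k, snd l \<cdot>\<^bsub>D\<^esub> snd k) else undefined)\<rparr>"

record ('o, 'm, 'p, 'n) fctor =
  fobj :: "'o \<Rightarrow> 'p"
  farr :: "'m \<Rightarrow> 'n"

locale cat_functor = A: category A + B: category B
  for A :: "('o, 'm) cat" and B :: "('p, 'n) cat" +
  fixes F :: "('o, 'm, 'p, 'n) fctor"
  assumes fobj_closed: "fobj F \<in> Obj A \<rightarrow>\<^sub>E Obj B"
    and farr_closed: "farr F \<in> Arr A \<rightarrow>\<^sub>E Arr B"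
    and Dom_farr: "f \<in> Arr A \<Longrightarrow> Dom B (farr F f) = fobj F (Dom A f)"
    and Cod_farr: "f \<in> Arr A \<Longrightarrow> Cod B (farr F f) = fobj F (Cod A f)"
    and farr_Idt: "x \<in> Obj A \<Longrightarrow> farr F (Idt A x) = Idt B (fobj F x)"
    and farr_Comp: "\<lbrakk>f \<in> Arr A; g \<in> Arr A; Dom A g = Cod A f\<rbrakk>
      \<Longrightarrow> farr F (g \<cdot>\<^bsub>A\<^esub> f) = farr F g \<cdot>\<^bsub>B\<^esub> farr F f"

definition id_fctor :: "('o, 'm) cat \<Rightarrow> ('o, 'm, 'o, 'm) fctor" where
  "id_fctor C = \<lparr>fobj = (\<lambda>x \<in> Obj C. x), farr = (\<lambda>f \<in> Arr C. f)\<rparr>"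

definition comp_fctor ::
  "('o, 'm) cat \<Rightarrow> ('p, 'n, 'q, 'k) fctor \<Rightarrow> ('o, 'm, 'p, 'n) fctor \<Rightarrow> ('o, 'm, 'q, 'k) fctor"
  where
  "comp_fctor C G F =
    \<lparr>fobj = compose (Obj C) (fobj G) (fobj F), farr = compose (Arr C) (farr G) (farr F)\<rparr>"

locale natural_iso = F: cat_functor A B F + G: cat_functor A B G
  for A :: "('o, 'm) cat" and B :: "('p, 'n) cat"
    and F :: "('o, 'm, 'p, 'n) fctor" and G :: "('o, 'm, 'p, 'n) fctor" +
  fixes \<tau> :: "'o \<Rightarrow> 'n"
  assumes component_iso: "x \<in> Obj A \<Longrightarrow> \<tau> x \<in> iso_hom B (fobj F x) (fobj G x)"
    and naturality: "f \<in> Arr A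
      \<Longrightarrow> \<tau> (Cod A f) \<cdot>\<^bsub>B\<^esub> farr F f = farr G f \<cdot>\<^bsub>B\<^esub> \<tau> (Dom A f)"

definition equivalence_of_categories ::
  "('o, 'm) cat \<Rightarrow> ('p, 'n) cat \<Rightarrow> ('o, 'm, 'p, 'n) fctor \<Rightarrow> bool" where
  "equivalence_of_categories A B F \<longleftrightarrow>
    cat_functor A B F \<and>
    (\<exists>G. cat_functor B A G \<and>
      (\<exists>\<eta>. natural_iso A A (id_fctor A) (comp_fctor A G F) \<eta>) \<and>
      (\<exists>\<epsilon>. natural_iso B B (comp_fctor B F G) (id_fctor B) \<epsilon>))"


section \<open>Monoidal categories and weak monoidal functors\<close>

record ('o, 'm) moncat =
  ucat :: "('o, 'm) cat"
  tensor :: "('o \<times> 'o, 'm \<times> 'm, 'o, 'm) fctor"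
  munit :: "'o"
  massoc :: "'o \<Rightarrow> 'o \<Rightarrow> 'o \<Rightarrow> 'm"
  mlunit :: "'o \<Rightarrow> 'm"
  mrunit :: "'o \<Rightarrow> 'm"

abbreviation tensor_obj :: "('o, 'm) moncat \<Rightarrow> 'o \<Rightarrow> 'o \<Rightarrow> 'o" (infixr "\<otimes>\<index>" 75) where
  "tensor_obj M x y \<equiv> fobj (tensor M) (x, y)"

abbreviation tensor_arr :: "('o, 'm) moncat \<Rightarrow> 'm \<Rightarrow> 'm \<Rightarrow> 'm" (infixr "\<odot>\<index>" 75) where
  "tensor_arr M f g \<equiv> farr (tensor M) (f, g)"

locale monoidal_category = U: category "ucat M" +
  tensor: cat_functor "prod_cat (ucat M) (ucat M)" "ucat M" "tensor M"
  for M :: "('o, 'm) moncat" (structure) +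
  assumes munit_closed: "munit M \<in> Obj (ucat M)"
    and massoc_iso: "\<lbrakk>x \<in> Obj (ucat M); y \<in> Obj (ucat M); z \<in> Obj (ucat M)\<rbrakk>
      \<Longrightarrow> massoc M x y z \<in> iso_hom (ucat M) ((x \<otimes> y) \<otimes> z) (x \<otimes> (y \<otimes> z))"
    and mlunit_iso: "x \<in> Obj (ucat M) \<Longrightarrow> mlunit M x \<in> iso_hom (ucat M) (munit M \<otimes> x) x"
    and mrunit_iso: "x \<in> Obj (ucat M) \<Longrightarrow> mrunit M x \<in> iso_hom (ucat M) (x \<otimes> munit M) x"
    and massoc_natural:
      "\<lbrakk>f \<in> hom (ucat M) x x'; g \<in> hom (ucat M) y y'; h \<in> hom (ucat M) z z'\<rbrakk>
        \<Longrightarrow> massoc M x' y' z' \<cdot>\<^bsub>ucat M\<^esub> ((f \<odot> g) \<odot> h)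
          = (f \<odot> (g \<odot> h)) \<cdot>\<^bsub>ucat M\<^esub> massoc M x y z"
    and mlunit_natural: "f \<in> hom (ucat M) x x'
      \<Longrightarrow> mlunit M x' \<cdot>\<^bsub>ucat M\<^esub> (Idt (ucat M) (munit M) \<odot> f) = f \<cdot>\<^bsub>ucat M\<^esub> mlunit M x"
    and mrunit_natural: "f \<in> hom (ucat M) x x'
      \<Longrightarrow> mrunit M x' \<cdot>\<^bsub>ucat M\<^esub> (f \<odot> Idt (ucat M) (munit M)) = f \<cdot>\<^bsub>ucat M\<^esub> mrunit M x"
    and pentagon:
      "\<lbrakk>w \<in> Obj (ucat M); x \<in> Obj (ucat M); y \<in> Obj (ucat M); z \<in> Obj (ucat M)\<rbrakk>
        \<Longrightarrow> (Idt (ucat M) w \<odot> massoc M x y z) \<cdot>\<^bsub>ucat M\<^esub> massoc M w (x \<otimes> y) z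
              \<cdot>\<^bsub>ucat M\<^esub> (massoc M w x y \<odot> Idt (ucat M) z)
          = massoc M w x (y \<otimes> z) \<cdot>\<^bsub>ucat M\<^esub> massoc M (w \<otimes> x) y z"
    and triangle: "\<lbrakk>x \<in> Obj (ucat M); y \<in> Obj (ucat M)\<rbrakk>
      \<Longrightarrow> (Idt (ucat M) x \<odot> mlunit M y) \<cdot>\<^bsub>ucat M\<^esub> massoc M x (munit M) y
        = mrunit M x \<odot> Idt (ucat M) y"
    and massoc_undefined:
      "\<not> (x \<in> Obj (ucat M) \<and> y \<in> Obj (ucat M) \<and> z \<in> Obj (ucat M))
        \<Longrightarrow> massoc M x y z = undefined"
    and mlunit_undefined: "x \<notin> Obj (ucat M) \<Longrightarrow> mlunit M x = undefined"
    and mrunit_undefined: "x \<notin> Obj (ucat M) \<Longrightarrow> mrunit M x = undefined"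

record ('o, 'm, 'p, 'n) monfun =
  ufun :: "('o, 'm, 'p, 'n) fctor"
  mcomp :: "'o \<Rightarrow> 'o \<Rightarrow> 'n"
  mid :: "'n"

locale monoidal_functor = M: monoidal_category M + N: monoidal_category N +
  ufun: cat_functor "ucat M" "ucat N" "ufun F"
  for M :: "('o, 'm) moncat" and N :: "('p, 'n) moncat" and F :: "('o, 'm, 'p, 'n) monfun" +
  assumes mcomp_iso: "\<lbrakk>x \<in> Obj (ucat M); y \<in> Obj (ucat M)\<rbrakk>
      \<Longrightarrow> mcomp F x y \<in> iso_hom (ucat N)
            (fobj (ufun F) x \<otimes>\<^bsub>N\<^esub> fobj (ufun F) y) (fobj (ufun F) (x \<otimes>\<^bsub>M\<^esub> y))"
    and mid_iso: "mid F \<in> iso_hom (ucat N) (munit N) (fobj (ufun F) (munit M))"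
    and mcomp_natural: "\<lbrakk>f \<in> hom (ucat M) x x'; g \<in> hom (ucat M) y y'\<rbrakk>
      \<Longrightarrow> mcomp F x' y' \<cdot>\<^bsub>ucat N\<^esub> (farr (ufun F) f \<odot>\<^bsub>N\<^esub> farr (ufun F) g)
        = farr (ufun F) (f \<odot>\<^bsub>M\<^esub> g) \<cdot>\<^bsub>ucat N\<^esub> mcomp F x y"
    and mfun_assoc: "\<lbrakk>x \<in> Obj (ucat M); y \<in> Obj (ucat M); z \<in> Obj (ucat M)\<rbrakk>
      \<Longrightarrow> farr (ufun F) (massoc M x y z) \<cdot>\<^bsub>ucat N\<^esub> mcomp F (x \<otimes>\<^bsub>M\<^esub> y) z
            \<cdot>\<^bsub>ucat N\<^esub> (mcomp F x y \<odot>\<^bsub>N\<^esub> Idt (ucat N) (fobj (ufun F) z))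
        = mcomp F x (y \<otimes>\<^bsub>M\<^esub> z)
            \<cdot>\<^bsub>ucat N\<^esub> (Idt (ucat N) (fobj (ufun F) x) \<odot>\<^bsub>N\<^esub> mcomp F y z)
            \<cdot>\<^bsub>ucat N\<^esub> massoc N (fobj (ufun F) x) (fobj (ufun F) y) (fobj (ufun F) z)"
    and mfun_lunit: "x \<in> Obj (ucat M)
      \<Longrightarrow> farr (ufun F) (mlunit M x) \<cdot>\<^bsub>ucat N\<^esub> mcomp F (munit M) x
            \<cdot>\<^bsub>ucat N\<^esub> (mid F \<odot>\<^bsub>N\<^esub> Idt (ucat N) (fobj (ufun F) x))
        = mlunit N (fobj (ufun F) x)"
    and mfun_runit: "x \<in> Obj (ucat M)
      \<Longrightarrow> farr (ufun F) (mrunit M x) \<cdot>\<^bsub>ucat N\<^esub> mcomp F x (munit M)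
            \<cdot>\<^bsub>ucat N\<^esub> (Idt (ucat N) (fobj (ufun F) x) \<odot>\<^bsub>N\<^esub> mid F)
        = mrunit N (fobj (ufun F) x)"
    and mcomp_undefined:
      "\<not> (x \<in> Obj (ucat M) \<and> y \<in> Obj (ucat M)) \<Longrightarrow> mcomp F x y = undefined"

definition id_monfun :: "('o, 'm) moncat \<Rightarrow> ('o, 'm, 'o, 'm) monfun" where
  "id_monfun M =
    \<lparr>ufun = id_fctor (ucat M),
     mcomp = (\<lambda>x y. if x \<in> Obj (ucat M) \<and> y \<in> Obj (ucat M)
       then Idt (ucat M) (x \<otimes>\<^bsub>M\<^esub> y) else undefined),
     mid = Idt (ucat M) (munit M)\<rparr>"

definition comp_monfun ::
  "('o, 'm) moncat \<Rightarrow> ('q, 'k) moncat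
    \<Rightarrow> ('p, 'n, 'q, 'k) monfun \<Rightarrow> ('o, 'm, 'p, 'n) monfun \<Rightarrow> ('o, 'm, 'q, 'k) monfun" where
  "comp_monfun M P G F =
    \<lparr>ufun = comp_fctor (ucat M) (ufun G) (ufun F),
     mcomp = (\<lambda>x y. if x \<in> Obj (ucat M) \<and> y \<in> Obj (ucat M)
       then farr (ufun G) (mcomp F x y)
         \<cdot>\<^bsub>ucat P\<^esub> mcomp G (fobj (ufun F) x) (fobj (ufun F) y)
       else undefined),
     mid = farr (ufun G) (mid F) \<cdot>\<^bsub>ucat P\<^esub> mid G\<rparr>"

text \<open>
  Arrows of the two categories of structures are triples (source, map, target), so that the
  source and target are part of the arrow.
\<close>

type_synonym ('o, 'm) monarr =
  "('o, 'm) moncat \<times> ('o, 'm, 'o, 'm) monfun \<times> ('o, 'm) moncat"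

definition monarrs :: "('o, 'm) monarr set" where
  "monarrs = {(M, F, N) | M F N. monoidal_functor M N F}"

definition MonCat1 :: "(('o, 'm) moncat, ('o, 'm) monarr) cat" where
  "MonCat1 =
    \<lparr>Obj = {M. monoidal_category M},
     Arr = monarrs,
     Dom = (\<lambda>(M, F, N) \<in> monarrs. M),
     Cod = (\<lambda>(M, F, N) \<in> monarrs. N),
     Idt = (\<lambda>M \<in> {M. monoidal_category M}. (M, id_monfun M, M)),
     Comp = (\<lambda>(N', G, P) (M, F, N).
       if (M, F, N) \<in> monarrs \<and> (N', G, P) \<in> monarrs \<and> N' = N
       then (M, comp_monfun M P G F, P) else undefined)\<rparr>"


section \<open>Bicategories and weak functors\<close>

text \<open>
  \<open>Homc B a b\<close> is the category of 1-cells and 2-cells from \<open>a\<close> to \<open>b\<close>, and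
  \<open>hcomp B a b c\<close> is the horizontal composition functor
  \<open>B(b,c) \<times> B(a,b) \<rightarrow> B(a,c)\<close>. The leading arguments of the remaining
  operations are the 0-cells involved, listed from source to target, followed by the 1-cells in
  applicative order, so \<open>bassoc B a b c d h g f\<close> is the component
  \<open>(h \<circ> g) \<circ> f \<Rightarrow> h \<circ> (g \<circ> f)\<close> for \<open>f : a \<rightarrow> b\<close>,
  \<open>g : b \<rightarrow> c\<close>, \<open>h : c \<rightarrow> d\<close>.
\<close>

record ('z, 'o, 'm) bicat =
  Cells0 :: "'z set"
  Homc :: "'z \<Rightarrow> 'z \<Rightarrow> ('o, 'm) cat"
  hcomp :: "'z \<Rightarrow> 'z \<Rightarrow> 'z \<Rightarrow> ('o \<times> 'o, 'm \<times> 'm, 'o, 'm) fctor"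
  unit1 :: "'z \<Rightarrow> 'o"
  bassoc :: "'z \<Rightarrow> 'z \<Rightarrow> 'z \<Rightarrow> 'z \<Rightarrow> 'o \<Rightarrow> 'o \<Rightarrow> 'o \<Rightarrow> 'm"
  blunit :: "'z \<Rightarrow> 'z \<Rightarrow> 'o \<Rightarrow> 'm"
  brunit :: "'z \<Rightarrow> 'z \<Rightarrow> 'o \<Rightarrow> 'm"

abbreviation hcomp1 :: "('z, 'o, 'm) bicat \<Rightarrow> 'z \<Rightarrow> 'z \<Rightarrow> 'z \<Rightarrow> 'o \<Rightarrow> 'o \<Rightarrow> 'o" where
  "hcomp1 B a b c g f \<equiv> fobj (hcomp B a b c) (g, f)"

abbreviation hcomp2 :: "('z, 'o, 'm) bicat \<Rightarrow> 'z \<Rightarrow> 'z \<Rightarrow> 'z \<Rightarrow> 'm \<Rightarrow> 'm \<Rightarrow> 'm" where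
  "hcomp2 B a b c \<beta> \<alpha> \<equiv> farr (hcomp B a b c) (\<beta>, \<alpha>)"

abbreviation cells1 :: "('z, 'o, 'm) bicat \<Rightarrow> 'z \<Rightarrow> 'z \<Rightarrow> 'o set" where
  "cells1 B a b \<equiv> Obj (Homc B a b)"

abbreviation idt2 :: "('z, 'o, 'm) bicat \<Rightarrow> 'z \<Rightarrow> 'z \<Rightarrow> 'o \<Rightarrow> 'm" where
  "idt2 B a b f \<equiv> Idt (Homc B a b) f"

locale bicategory =
  fixes B :: "('z, 'o, 'm) bicat"
  assumes Homc_category: "\<lbrakk>a \<in> Cells0 B; b \<in> Cells0 B\<rbrakk> \<Longrightarrow> category (Homc B a b)"
    and hcomp_functor: "\<lbrakk>a \<in> Cells0 B; b \<in> Cells0 B; c \<in> Cells0 B\<rbrakk>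
      \<Longrightarrow> cat_functor (prod_cat (Homc B b c) (Homc B a b)) (Homc B a c) (hcomp B a b c)"
    and unit1_closed: "a \<in> Cells0 B \<Longrightarrow> unit1 B a \<in> cells1 B a a"
    and bassoc_iso:
      "\<lbrakk>a \<in> Cells0 B; b \<in> Cells0 B; c \<in> Cells0 B; d \<in> Cells0 B;
        h \<in> cells1 B c d; g \<in> cells1 B b c; f \<in> cells1 B a b\<rbrakk>
        \<Longrightarrow> bassoc B a b c d h g f \<in> iso_hom (Homc B a d)
              (hcomp1 B a b d (hcomp1 B b c d h g) f) (hcomp1 B a c d h (hcomp1 B a b c g f))"
    and blunit_iso: "\<lbrakk>a \<in> Cells0 B; b \<in> Cells0 B; f \<in> cells1 B a b\<rbrakk>
      \<Longrightarrow> blunit B a b f \<in> iso_hom (Homc B a b) (hcomp1 B a b b (unit1 B b) f) f"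
    and brunit_iso: "\<lbrakk>a \<in> Cells0 B; b \<in> Cells0 B; f \<in> cells1 B a b\<rbrakk>
      \<Longrightarrow> brunit B a b f \<in> iso_hom (Homc B a b) (hcomp1 B a a b f (unit1 B a)) f"
    and bassoc_natural:
      "\<lbrakk>a \<in> Cells0 B; b \<in> Cells0 B; c \<in> Cells0 B; d \<in> Cells0 B;
        \<gamma> \<in> hom (Homc B c d) h h'; \<beta> \<in> hom (Homc B b c) g g'; \<alpha> \<in> hom (Homc B a b) f f'\<rbrakk>
        \<Longrightarrow> bassoc B a b c d h' g' f'
              \<cdot>\<^bsub>Homc B a d\<^esub> hcomp2 B a b d (hcomp2 B b c d \<gamma> \<beta>) \<alpha>
          = hcomp2 B a c d \<gamma> (hcomp2 B a b c \<beta> \<alpha>) \<cdot>\<^bsub>Homc B a d\<^esub> bassoc B a b c d h g f"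
    and blunit_natural:
      "\<lbrakk>a \<in> Cells0 B; b \<in> Cells0 B; \<alpha> \<in> hom (Homc B a b) f f'\<rbrakk>
        \<Longrightarrow> blunit B a b f' \<cdot>\<^bsub>Homc B a b\<^esub> hcomp2 B a b b (idt2 B b b (unit1 B b)) \<alpha>
          = \<alpha> \<cdot>\<^bsub>Homc B a b\<^esub> blunit B a b f"
    and brunit_natural:
      "\<lbrakk>a \<in> Cells0 B; b \<in> Cells0 B; \<alpha> \<in> hom (Homc B a b) f f'\<rbrakk>
        \<Longrightarrow> brunit B a b f' \<cdot>\<^bsub>Homc B a b\<^esub> hcomp2 B a a b \<alpha> (idt2 B a a (unit1 B a))
          = \<alpha> \<cdot>\<^bsub>Homc B a b\<^esub> brunit B a b f"
    and bpentagon: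
      "\<lbrakk>a \<in> Cells0 B; b \<in> Cells0 B; c \<in> Cells0 B; d \<in> Cells0 B; e \<in> Cells0 B;
        k \<in> cells1 B d e; h \<in> cells1 B c d; g \<in> cells1 B b c; f \<in> cells1 B a b\<rbrakk>
        \<Longrightarrow> hcomp2 B a d e (idt2 B d e k) (bassoc B a b c d h g f)
              \<cdot>\<^bsub>Homc B a e\<^esub> bassoc B a b d e k (hcomp1 B b c d h g) f
              \<cdot>\<^bsub>Homc B a e\<^esub> hcomp2 B a b e (bassoc B b c d e k h g) (idt2 B a b f)
          = bassoc B a c d e k h (hcomp1 B a b c g f)
              \<cdot>\<^bsub>Homc B a e\<^esub> bassoc B a b c e (hcomp1 B c d e k h) g f"
    and btriangle:
      "\<lbrakk>a \<in> Cells0 B; b \<in> Cells0 B; c \<in> Cells0 B; g \<in> cells1 B b c; f \<in> cells1 B a b\<rbrakk>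
        \<Longrightarrow> hcomp2 B a b c (idt2 B b c g) (blunit B a b f)
              \<cdot>\<^bsub>Homc B a c\<^esub> bassoc B a b b c g (unit1 B b) f
          = hcomp2 B a b c (brunit B b c g) (idt2 B a b f)"
    and Homc_undefined: "\<not> (a \<in> Cells0 B \<and> b \<in> Cells0 B) \<Longrightarrow> Homc B a b = undefined"
    and hcomp_undefined:
      "\<not> (a \<in> Cells0 B \<and> b \<in> Cells0 B \<and> c \<in> Cells0 B) \<Longrightarrow> hcomp B a b c = undefined"
    and unit1_undefined: "a \<notin> Cells0 B \<Longrightarrow> unit1 B a = undefined"
    and bassoc_undefined:
      "\<not> (a \<in> Cells0 B \<and> b \<in> Cells0 B \<and> c \<in> Cells0 B \<and> d \<in> Cells0 B \<and>
          h \<in> cells1 B c d \<and> g \<in> cells1 B b c \<and> f \<in> cells1 B a b)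
        \<Longrightarrow> bassoc B a b c d h g f = undefined"
    and blunit_undefined:
      "\<not> (a \<in> Cells0 B \<and> b \<in> Cells0 B \<and> f \<in> cells1 B a b) \<Longrightarrow> blunit B a b f = undefined"
    and brunit_undefined:
      "\<not> (a \<in> Cells0 B \<and> b \<in> Cells0 B \<and> f \<in> cells1 B a b) \<Longrightarrow> brunit B a b f = undefined"

record ('z, 'o, 'm, 'y, 'p, 'n) wfun =
  wmap :: "'z \<Rightarrow> 'y"
  whom :: "'z \<Rightarrow> 'z \<Rightarrow> ('o, 'm, 'p, 'n) fctor"
  wcomp :: "'z \<Rightarrow> 'z \<Rightarrow> 'z \<Rightarrow> 'o \<Rightarrow> 'o \<Rightarrow> 'n"
  wunit :: "'z \<Rightarrow> 'n"

abbreviation wmap1 :: "('z, 'o, 'm, 'y, 'p, 'n) wfun \<Rightarrow> 'z \<Rightarrow> 'z \<Rightarrow> 'o \<Rightarrow> 'p" where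
  "wmap1 F a b f \<equiv> fobj (whom F a b) f"

abbreviation wmap2 :: "('z, 'o, 'm, 'y, 'p, 'n) wfun \<Rightarrow> 'z \<Rightarrow> 'z \<Rightarrow> 'm \<Rightarrow> 'n" where
  "wmap2 F a b \<alpha> \<equiv> farr (whom F a b) \<alpha>"

locale weak_functor = B: bicategory B + C: bicategory C
  for B :: "('z, 'o, 'm) bicat" and C :: "('y, 'p, 'n) bicat" +
  fixes F :: "('z, 'o, 'm, 'y, 'p, 'n) wfun"
  assumes wmap_closed: "wmap F \<in> Cells0 B \<rightarrow>\<^sub>E Cells0 C"
    and whom_functor: "\<lbrakk>a \<in> Cells0 B; b \<in> Cells0 B\<rbrakk>
      \<Longrightarrow> cat_functor (Homc B a b) (Homc C (wmap F a) (wmap F b)) (whom F a b)"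
    and wcomp_iso:
      "\<lbrakk>a \<in> Cells0 B; b \<in> Cells0 B; c \<in> Cells0 B; g \<in> cells1 B b c; f \<in> cells1 B a b\<rbrakk>
        \<Longrightarrow> wcomp F a b c g f \<in> iso_hom (Homc C (wmap F a) (wmap F c))
              (hcomp1 C (wmap F a) (wmap F b) (wmap F c) (wmap1 F b c g) (wmap1 F a b f))
              (wmap1 F a c (hcomp1 B a b c g f))"
    and wunit_iso: "a \<in> Cells0 B
      \<Longrightarrow> wunit F a \<in> iso_hom (Homc C (wmap F a) (wmap F a))
            (unit1 C (wmap F a)) (wmap1 F a a (unit1 B a))"
    and wcomp_natural:
      "\<lbrakk>a \<in> Cells0 B; b \<in> Cells0 B; c \<in> Cells0 B;
        \<beta> \<in> hom (Homc B b c) g g'; \<alpha> \<in> hom (Homc B a b) f f'\<rbrakk>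
        \<Longrightarrow> wcomp F a b c g' f'
              \<cdot>\<^bsub>Homc C (wmap F a) (wmap F c)\<^esub>
                hcomp2 C (wmap F a) (wmap F b) (wmap F c) (wmap2 F b c \<beta>) (wmap2 F a b \<alpha>)
          = wmap2 F a c (hcomp2 B a b c \<beta> \<alpha>)
              \<cdot>\<^bsub>Homc C (wmap F a) (wmap F c)\<^esub> wcomp F a b c g f"
    and wfun_assoc:
      "\<lbrakk>a \<in> Cells0 B; b \<in> Cells0 B; c \<in> Cells0 B; d \<in> Cells0 B;
        h \<in> cells1 B c d; g \<in> cells1 B b c; f \<in> cells1 B a b\<rbrakk>
        \<Longrightarrow> wmap2 F a d (bassoc B a b c d h g f)
              \<cdot>\<^bsub>Homc C (wmap F a) (wmap F d)\<^esub> wcomp F a b d (hcomp1 B b c d h g) f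
              \<cdot>\<^bsub>Homc C (wmap F a) (wmap F d)\<^esub>
                hcomp2 C (wmap F a) (wmap F b) (wmap F d)
                  (wcomp F b c d h g) (idt2 C (wmap F a) (wmap F b) (wmap1 F a b f))
          = wcomp F a c d h (hcomp1 B a b c g f)
              \<cdot>\<^bsub>Homc C (wmap F a) (wmap F d)\<^esub>
                hcomp2 C (wmap F a) (wmap F c) (wmap F d)
                  (idt2 C (wmap F c) (wmap F d) (wmap1 F c d h)) (wcomp F a b c g f)
              \<cdot>\<^bsub>Homc C (wmap F a) (wmap F d)\<^esub>
                bassoc C (wmap F a) (wmap F b) (wmap F c) (wmap F d)
                  (wmap1 F c d h) (wmap1 F b c g) (wmap1 F a b f)"
    and wfun_lunit: "\<lbrakk>a \<in> Cells0 B; b \<in> Cells0 B; f \<in> cells1 B a b\<rbrakk>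
      \<Longrightarrow> wmap2 F a b (blunit B a b f)
            \<cdot>\<^bsub>Homc C (wmap F a) (wmap F b)\<^esub> wcomp F a b b (unit1 B b) f
            \<cdot>\<^bsub>Homc C (wmap F a) (wmap F b)\<^esub>
              hcomp2 C (wmap F a) (wmap F b) (wmap F b)
                (wunit F b) (idt2 C (wmap F a) (wmap F b) (wmap1 F a b f))
        = blunit C (wmap F a) (wmap F b) (wmap1 F a b f)"
    and wfun_runit: "\<lbrakk>a \<in> Cells0 B; b \<in> Cells0 B; f \<in> cells1 B a b\<rbrakk>
      \<Longrightarrow> wmap2 F a b (brunit B a b f)
            \<cdot>\<^bsub>Homc C (wmap F a) (wmap F b)\<^esub> wcomp F a a b f (unit1 B a)
            \<cdot>\<^bsub>Homc C (wmap F a) (wmap F b)\<^esub>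
              hcomp2 C (wmap F a) (wmap F a) (wmap F b)
                (idt2 C (wmap F a) (wmap F b) (wmap1 F a b f)) (wunit F a)
        = brunit C (wmap F a) (wmap F b) (wmap1 F a b f)"
    and whom_undefined: "\<not> (a \<in> Cells0 B \<and> b \<in> Cells0 B) \<Longrightarrow> whom F a b = undefined"
    and wcomp_undefined:
      "\<not> (a \<in> Cells0 B \<and> b \<in> Cells0 B \<and> c \<in> Cells0 B \<and> g \<in> cells1 B b c \<and> f \<in> cells1 B a b)
        \<Longrightarrow> wcomp F a b c g f = undefined"
    and wunit_undefined: "a \<notin> Cells0 B \<Longrightarrow> wunit F a = undefined"

definition id_wfun :: "('z, 'o, 'm) bicat \<Rightarrow> ('z, 'o, 'm, 'z, 'o, 'm) wfun" where
  "id_wfun B =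
    \<lparr>wmap = (\<lambda>a \<in> Cells0 B. a),
     whom = (\<lambda>a b. if a \<in> Cells0 B \<and> b \<in> Cells0 B then id_fctor (Homc B a b) else undefined),
     wcomp = (\<lambda>a b c g f.
       if a \<in> Cells0 B \<and> b \<in> Cells0 B \<and> c \<in> Cells0 B \<and> g \<in> cells1 B b c \<and> f \<in> cells1 B a b
       then idt2 B a c (hcomp1 B a b c g f) else undefined),
     wunit = (\<lambda>a \<in> Cells0 B. idt2 B a a (unit1 B a))\<rparr>"

definition comp_wfun ::
  "('z, 'o, 'm) bicat \<Rightarrow> ('x, 'q, 'k) bicat
    \<Rightarrow> ('y, 'p, 'n, 'x, 'q, 'k) wfun \<Rightarrow> ('z, 'o, 'm, 'y, 'p, 'n) wfun
    \<Rightarrow> ('z, 'o, 'm, 'x, 'q, 'k) wfun" where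
  "comp_wfun B D G F =
    \<lparr>wmap = compose (Cells0 B) (wmap G) (wmap F),
     whom = (\<lambda>a b. if a \<in> Cells0 B \<and> b \<in> Cells0 B
       then comp_fctor (Homc B a b) (whom G (wmap F a) (wmap F b)) (whom F a b)
       else undefined),
     wcomp = (\<lambda>a b c g f.
       if a \<in> Cells0 B \<and> b \<in> Cells0 B \<and> c \<in> Cells0 B \<and> g \<in> cells1 B b c \<and> f \<in> cells1 B a b
       then wmap2 G (wmap F a) (wmap F c) (wcomp F a b c g f)
         \<cdot>\<^bsub>Homc D (wmap G (wmap F a)) (wmap G (wmap F c))\<^esub>
           wcomp G (wmap F a) (wmap F b) (wmap F c) (wmap1 F b c g) (wmap1 F a b f)
       else undefined),
     wunit = (\<lambda>a \<in> Cells0 B.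
       wmap2 G (wmap F a) (wmap F a) (wunit F a)
         \<cdot>\<^bsub>Homc D (wmap G (wmap F a)) (wmap G (wmap F a))\<^esub> wunit G (wmap F a))\<rparr>"


section \<open>Degenerate bicategories and the comparison functor\<close>

text \<open>The parameter \<open>pt\<close> is the fixed 0-cell shared by all degenerate bicategories.\<close>

definition degenerate_bicategory :: "'z \<Rightarrow> ('z, 'o, 'm) bicat \<Rightarrow> bool" where
  "degenerate_bicategory pt B \<longleftrightarrow> bicategory B \<and> Cells0 B = {pt}"

type_synonym ('z, 'o, 'm) biarr =
  "('z, 'o, 'm) bicat \<times> ('z, 'o, 'm, 'z, 'o, 'm) wfun \<times> ('z, 'o, 'm) bicat"

definition degenerate_biarrs :: "'z \<Rightarrow> ('z, 'o, 'm) biarr set" where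
  "degenerate_biarrs pt =
    {(B, F, C) | B F C.
      degenerate_bicategory pt B \<and> degenerate_bicategory pt C \<and> weak_functor B C F}"

definition Bicat1 :: "'z \<Rightarrow> (('z, 'o, 'm) bicat, ('z, 'o, 'm) biarr) cat" where
  "Bicat1 pt =
    \<lparr>Obj = {B. degenerate_bicategory pt B},
     Arr = degenerate_biarrs pt,
     Dom = (\<lambda>(B, F, C) \<in> degenerate_biarrs pt. B),
     Cod = (\<lambda>(B, F, C) \<in> degenerate_biarrs pt. C),
     Idt = (\<lambda>B \<in> {B. degenerate_bicategory pt B}. (B, id_wfun B, B)),
     Comp = (\<lambda>(C', G, D) (B, F, C).
       if (B, F, C) \<in> degenerate_biarrs pt \<and> (C', G, D) \<in> degenerate_biarrs pt \<and> C' = C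
       then (B, comp_wfun B D G F, D) else undefined)\<rparr>"

definition xi_obj :: "'z \<Rightarrow> ('z, 'o, 'm) bicat \<Rightarrow> ('o, 'm) moncat" where
  "xi_obj pt B =
    \<lparr>ucat = Homc B pt pt,
     tensor = hcomp B pt pt pt,
     munit = unit1 B pt,
     massoc = bassoc B pt pt pt pt,
     mlunit = blunit B pt pt,
     mrunit = brunit B pt pt\<rparr>"

definition xi_fun :: "'z \<Rightarrow> ('z, 'o, 'm, 'z, 'p, 'n) wfun \<Rightarrow> ('o, 'm, 'p, 'n) monfun" where
  "xi_fun pt F =
    \<lparr>ufun = whom F pt pt,
     mcomp = wcomp F pt pt pt,
     mid = wunit F pt\<rparr>"

definition xi ::
  "'z \<Rightarrow> (('z, 'o, 'm) bicat, ('z, 'o, 'm) biarr, ('o, 'm) moncat, ('o, 'm) monarr) fctor" where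
  "xi pt =
    \<lparr>fobj = (\<lambda>B \<in> {B. degenerate_bicategory pt B}. xi_obj pt B),
     farr = (\<lambda>(B, F, C) \<in> degenerate_biarrs pt. (xi_obj pt B, xi_fun pt F, xi_obj pt C))\<rparr>"

end

theory Submission
  imports Defs
begin

text \<open>
  With a single 0-cell, all the data and axioms of a bicategory or weak functor sit at the 0-cell
  \<open>pt\<close>, and there they coincide with those of a monoidal category or monoidal functor. Hence
  \<open>xi\<close> is bijective on objects and on arrows and matches identities and composites. It
  remains to see that monoidal functors compose; the category axioms for \<^const>\<open>Bicat1\<close>
  are then transported back along \<open>xi\<close>, and the inverse bijections form an inverse functor.
\<close>

section \<open>Homsets and functors\<close>

text \<open>The bijection is strict because of two conventions. Every operation is
  \<open>undefined\<close> off its domain, so a structure carries no data beyond that at the single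
  0-cell; and this 0-cell is the same \<open>pt\<close> for all bicategories, so \<open>xi\<close>
  forgets nothing. With a varying 0-cell, injectivity on objects would fail and an inverse would
  exist only up to isomorphism. The obstacle is composition: proving directly that weak functors
  compose is a diagram chase with 0-cell indices on every constraint. The chase is carried out once
  for monoidal functors, where the indices are gone. At \<open>pt\<close> weak functors compose by
  the same formulas, so closure under composition returns through the bijection, and associativity
  and the unit laws follow from injectivity of \<open>xi\<close>.\<close>

context category
begin

lemma Dom_Obj: "f \<in> Arr C \<Longrightarrow> Dom C f \<in> Obj C"
  using Dom_closed by auto

lemma Cod_Obj: "f \<in> Arr C \<Longrightarrow> Cod C f \<in> Obj C"
  using Cod_closed by auto

lemma Idt_Arr: "x \<in> Obj C \<Longrightarrow> Idt C x \<in> Arr C"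
  using Idt_closed by auto

lemma hom_Obj: "f \<in> hom C x y \<Longrightarrow> x \<in> Obj C \<and> y \<in> Obj C"
  using Dom_Obj Cod_Obj by (auto simp: hom_def)

lemma Idt_hom: "x \<in> Obj C \<Longrightarrow> Idt C x \<in> hom C x x"
  using Idt_Arr Dom_Idt Cod_Idt by (auto simp: hom_def)

text \<open>In the \<open>hom\<close> form both endpoints stand in the premises, so composability is
  a matter of unification and long composites can be typed by resolution alone.\<close>

lemma Comp_hom: "\<lbrakk>f \<in> hom C x y; g \<in> hom C y z\<rbrakk> \<Longrightarrow> g \<cdot> f \<in> hom C x z"
  using Comp_closed Dom_Comp Cod_Comp by (auto simp: hom_def)

lemma Comp_assoc_hom:
  "\<lbrakk>f \<in> hom C w x; g \<in> hom C x y; h \<in> hom C y z\<rbrakk> \<Longrightarrow> (h \<cdot> g) \<cdot> f = h \<cdot> (g \<cdot> f)"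
  using Comp_assoc by (auto simp: hom_def)

lemma Comp_Idt_hom: "f \<in> hom C x y \<Longrightarrow> f \<cdot> Idt C x = f"
  using Comp_Idt_right by (auto simp: hom_def)

lemma Idt_Comp_hom: "f \<in> hom C x y \<Longrightarrow> Idt C y \<cdot> f = f"
  using Comp_Idt_left by (auto simp: hom_def)

lemma Idt_iso_hom: "x \<in> Obj C \<Longrightarrow> Idt C x \<in> iso_hom C x x"
  using Idt_hom Comp_Idt_hom[OF Idt_hom] by (auto simp: iso_hom_def)

text \<open>The inverse is \<open>f' \<cdot> g'\<close>; each of the two products regroups around an
  inner pair that cancels to an identity.\<close>

lemma Comp_iso_hom:
  assumes f: "f \<in> iso_hom C x y" and g: "g \<in> iso_hom C y z"
  shows "g \<cdot> f \<in> iso_hom C x z"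
proof -
  from f obtain f' where f': "f \<in> hom C x y" "f' \<in> hom C y x"
    "f' \<cdot> f = Idt C x" "f \<cdot> f' = Idt C y"
    by (auto simp: iso_hom_def)
  from g obtain g' where g': "g \<in> hom C y z" "g' \<in> hom C z y"
    "g' \<cdot> g = Idt C y" "g \<cdot> g' = Idt C z"
    by (auto simp: iso_hom_def)
  have "(f' \<cdot> g') \<cdot> (g \<cdot> f) = f' \<cdot> (g' \<cdot> g) \<cdot> f"
    using Comp_assoc_hom[OF Comp_hom[OF f'(1) g'(1)] g'(2) f'(2)]
      Comp_assoc_hom[OF f'(1) g'(1) g'(2)] by simp
  moreover have "(g \<cdot> f) \<cdot> (f' \<cdot> g') = g \<cdot> (f \<cdot> f') \<cdot> g'"
    using Comp_assoc_hom[OF Comp_hom[OF g'(2) f'(2)] f'(1) g'(1)]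
      Comp_assoc_hom[OF g'(2) f'(2) f'(1)] by simp
  ultimately show ?thesis
    using f' g' Comp_hom[OF f'(1) g'(1)] Comp_hom[OF g'(2) f'(2)]
    by (auto simp: iso_hom_def Idt_Comp_hom)
qed

end

lemma iso_hom_hom: "f \<in> iso_hom C x y \<Longrightarrow> f \<in> hom C x y"
  by (simp add: iso_hom_def)

context cat_functor
begin

lemma fobj_Obj: "x \<in> Obj A \<Longrightarrow> fobj F x \<in> Obj B"
  using fobj_closed by auto

lemma farr_Arr: "f \<in> Arr A \<Longrightarrow> farr F f \<in> Arr B"
  using farr_closed by auto

lemma farr_hom: "f \<in> hom A x y \<Longrightarrow> farr F f \<in> hom B (fobj F x) (fobj F y)"
  using farr_Arr Dom_farr Cod_farr by (auto simp: hom_def)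

lemma farr_Comp_hom:
  "\<lbrakk>f \<in> hom A x y; g \<in> hom A y z\<rbrakk> \<Longrightarrow> farr F (g \<cdot>\<^bsub>A\<^esub> f) = farr F g \<cdot>\<^bsub>B\<^esub> farr F f"
  using farr_Comp by (auto simp: hom_def)

lemma farr_iso_hom:
  assumes "f \<in> iso_hom A x y"
  shows "farr F f \<in> iso_hom B (fobj F x) (fobj F y)"
proof -
  from assms obtain g where g: "f \<in> hom A x y" "g \<in> hom A y x"
    "g \<cdot>\<^bsub>A\<^esub> f = Idt A x" "f \<cdot>\<^bsub>A\<^esub> g = Idt A y"
    by (auto simp: iso_hom_def)
  then have "farr F g \<cdot>\<^bsub>B\<^esub> farr F f = Idt B (fobj F x)"
    "farr F f \<cdot>\<^bsub>B\<^esub> farr F g = Idt B (fobj F y)"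
    using A.hom_Obj by (metis farr_Comp_hom farr_Idt)+
  with g show ?thesis
    using farr_hom by (auto simp: iso_hom_def)
qed

end

lemma id_cat_functor:
  assumes "category A"
  shows "cat_functor A A (id_fctor A)"
proof -
  interpret category A by fact
  show ?thesis
    by unfold_locales
      (auto simp: id_fctor_def Dom_Obj Cod_Obj Idt_Arr Comp_closed)
qed

lemma comp_cat_functor:
  assumes "cat_functor A B F" "cat_functor B C G"
  shows "cat_functor A C (comp_fctor A G F)"
proof -
  interpret F: cat_functor A B F by fact
  interpret G: cat_functor B C G by fact
  show ?thesis
    by unfold_locales
      (auto simp: comp_fctor_def compose_def F.Dom_farr G.Dom_farr F.Cod_farr G.Cod_farr
        F.farr_Idt G.farr_Idt F.farr_Comp G.farr_Comp F.A.Comp_closed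
        F.A.Dom_Obj F.A.Cod_Obj F.A.Idt_Arr F.fobj_Obj F.farr_Arr G.fobj_Obj G.farr_Arr)
qed

section \<open>Unit and associativity laws for composition of functors\<close>

context cat_functor
begin

text \<open>Values off the carriers are pinned down, which turns the laws below into equations
  between records instead of agreement on objects and arrows only.\<close>

lemma fobj_arb: "x \<notin> Obj A \<Longrightarrow> fobj F x = undefined"
  using fobj_closed by (rule PiE_arb)

lemma farr_arb: "f \<notin> Arr A \<Longrightarrow> farr F f = undefined"
  using farr_closed by (rule PiE_arb)

lemma comp_id_fctor: "comp_fctor A F (id_fctor A) = F"
  by (rule fctor.equality)
    (auto simp: comp_fctor_def id_fctor_def compose_def fun_eq_iff fobj_arb farr_arb)

lemma id_comp_fctor: "comp_fctor A (id_fctor B) F = F"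
  by (rule fctor.equality)
    (auto simp: comp_fctor_def id_fctor_def compose_def fun_eq_iff fobj_arb farr_arb
      fobj_Obj farr_Arr)

lemma comp_fctor_assoc: "comp_fctor A (comp_fctor B H G) F = comp_fctor A H (comp_fctor A G F)"
  by (rule fctor.equality)
    (auto simp: comp_fctor_def compose_def fun_eq_iff fobj_Obj farr_Arr)

end

section \<open>Composition of monoidal functors\<close>

context monoidal_category
begin

lemma tensor_Obj: "\<lbrakk>x \<in> Obj (ucat M); y \<in> Obj (ucat M)\<rbrakk> \<Longrightarrow> x \<otimes> y \<in> Obj (ucat M)"
  using tensor.fobj_Obj[of "(x, y)"] by (simp add: prod_cat_def)

lemma tensor_hom:
  "\<lbrakk>f \<in> hom (ucat M) x x'; g \<in> hom (ucat M) y y'\<rbrakk>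
    \<Longrightarrow> f \<odot> g \<in> hom (ucat M) (x \<otimes> y) (x' \<otimes> y')"
  using tensor.farr_hom[of "(f, g)" "(x, y)" "(x', y')"] by (auto simp: prod_cat_def hom_def)

text \<open>The interchange law: the tensor is a functor on the product category, where composition
  is componentwise.\<close>

lemma tensor_Comp:
  "\<lbrakk>f \<in> hom (ucat M) x x'; f' \<in> hom (ucat M) x' x'';
    g \<in> hom (ucat M) y y'; g' \<in> hom (ucat M) y' y''\<rbrakk>
    \<Longrightarrow> (f' \<cdot>\<^bsub>ucat M\<^esub> f) \<odot> (g' \<cdot>\<^bsub>ucat M\<^esub> g) = (f' \<odot> g') \<cdot>\<^bsub>ucat M\<^esub> (f \<odot> g)"
  using tensor.farr_Comp[of "(f, g)" "(f', g')"] by (auto simp: prod_cat_def hom_def)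

lemma tensor_Idt:
  "\<lbrakk>x \<in> Obj (ucat M); y \<in> Obj (ucat M)\<rbrakk>
    \<Longrightarrow> Idt (ucat M) x \<odot> Idt (ucat M) y = Idt (ucat M) (x \<otimes> y)"
  using tensor.farr_Idt[of "(x, y)"] by (simp add: prod_cat_def)

lemma id_monoidal_functor: "monoidal_functor M M (id_monfun M)"
proof (intro monoidal_functor.intro)
  show "cat_functor (ucat M) (ucat M) (ufun (id_monfun M))"
    using id_cat_functor[OF U.category_axioms] by (simp add: id_monfun_def)
  have arr: "f \<in> hom (ucat M) x y \<Longrightarrow> f \<in> Arr (ucat M)" for f x y
    by (simp add: hom_def)
  show "monoidal_functor_axioms M M (id_monfun M)"
  proof (rule monoidal_functor_axioms.intro, goal_cases)
    \<comment> \<open>Cases 3 to 6 are naturality, associativity and the two unit conditions. All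
      constraints are identities, and \<open>tensor_Idt\<close> keeps them identities after
      tensoring.\<close>
    case (3 f x x' g y y')
    then show ?case
      using U.hom_Obj tensor_hom[OF 3]
      by (auto simp: id_monfun_def id_fctor_def arr U.Comp_Idt_hom U.Idt_Comp_hom)
  next
    case (4 x y z)
    then show ?case
      using massoc_iso[OF 4, THEN iso_hom_hom]
      by (simp add: id_monfun_def id_fctor_def arr tensor_Obj tensor_Idt U.Idt_hom
          U.Comp_Idt_hom[OF U.Idt_hom] U.Comp_Idt_hom U.Idt_Comp_hom)
  next
    case (5 x)
    then show ?case
      using mlunit_iso[OF 5, THEN iso_hom_hom]
      by (simp add: id_monfun_def id_fctor_def arr tensor_Obj tensor_Idt munit_closed
          U.Comp_Idt_hom[OF U.Idt_hom] U.Comp_Idt_hom)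
  next
    case (6 x)
    then show ?case
      using mrunit_iso[OF 6, THEN iso_hom_hom]
      by (simp add: id_monfun_def id_fctor_def arr tensor_Obj tensor_Idt munit_closed
          U.Comp_Idt_hom[OF U.Idt_hom] U.Comp_Idt_hom)
  qed (auto simp: id_monfun_def id_fctor_def tensor_Obj munit_closed U.Idt_iso_hom)
qed (fact monoidal_category_axioms)+

end

text \<open>
  The common part of the coherence conditions for a composite functor \<open>G F\<close>: after
  the square \<open>v w = g v'\<close> (naturality of the constraint of \<open>G\<close>) has been
  applied, \<open>a u g\<close> is the image of one side of the condition for \<open>F\<close>, and what
  remains belongs to the condition for \<open>G\<close>.
\<close>

lemma (in category) Comp_paste:
  assumes "x \<in> hom C o1 o2" "w \<in> hom C o2 o3" "v \<in> hom C o3 o4" "u \<in> hom C o4 o5"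
    "a \<in> hom C o5 o6" "v' \<in> hom C o2 o7" "g \<in> hom C o7 o4"
    and square: "v \<cdot> w = g \<cdot> v'"
  shows "a \<cdot> (u \<cdot> v) \<cdot> (w \<cdot> x) = (a \<cdot> u \<cdot> g) \<cdot> v' \<cdot> x"
proof -
  have D: "f \<in> hom C y z \<Longrightarrow> f \<in> Arr C \<and> Dom C f = y \<and> Cod C f = z" for f y z
    by (simp add: hom_def)
  note D = assms(1-7)[THEN D]
  have "a \<cdot> (u \<cdot> v) \<cdot> (w \<cdot> x) = a \<cdot> u \<cdot> (v \<cdot> w) \<cdot> x"
    by (simp add: D Comp_assoc Comp_closed Dom_Comp Cod_Comp)
  also have "\<dots> = (a \<cdot> u \<cdot> g) \<cdot> v' \<cdot> x"
    unfolding square by (simp add: D Comp_assoc Comp_closed Dom_Comp Cod_Comp)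
  finally show ?thesis .
qed

section \<open>Coherence conditions for a composite of monoidal functors\<close>

locale monoidal_functor_pair = F: monoidal_functor M N F + G: monoidal_functor N P G
  for M :: "('o, 'm) moncat" and N :: "('p, 'n) moncat" and P :: "('q, 'k) moncat"
    and F :: "('o, 'm, 'p, 'n) monfun" and G :: "('p, 'n, 'q, 'k) monfun"
begin

abbreviation "MO \<equiv> Obj (ucat M)"
abbreviation "fo \<equiv> fobj (ufun F)"
abbreviation "go \<equiv> fobj (ufun G)"
abbreviation "fa \<equiv> farr (ufun F)"
abbreviation "ga \<equiv> farr (ufun G)"
abbreviation compP (infixr "\<star>" 70) where "compP \<equiv> Comp (ucat P)"
abbreviation "IP \<equiv> Idt (ucat P)"
abbreviation "IN \<equiv> Idt (ucat N)"

lemma F_mcomp_hom: "\<lbrakk>x \<in> MO; y \<in> MO\<rbrakk>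
    \<Longrightarrow> mcomp F x y \<in> hom (ucat N) (fo x \<otimes>\<^bsub>N\<^esub> fo y) (fo (x \<otimes>\<^bsub>M\<^esub> y))"
  by (rule F.mcomp_iso[THEN iso_hom_hom])

lemma G_mcomp_hom: "\<lbrakk>x \<in> Obj (ucat N); y \<in> Obj (ucat N)\<rbrakk>
    \<Longrightarrow> mcomp G x y \<in> hom (ucat P) (go x \<otimes>\<^bsub>P\<^esub> go y) (go (x \<otimes>\<^bsub>N\<^esub> y))"
  by (rule G.mcomp_iso[THEN iso_hom_hom])

lemma F_mid_hom: "mid F \<in> hom (ucat N) (munit N) (fo (munit M))"
  by (rule F.mid_iso[THEN iso_hom_hom])

lemma G_mid_hom: "mid G \<in> hom (ucat P) (munit P) (go (munit N))"
  by (rule G.mid_iso[THEN iso_hom_hom])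

lemma comp_mcomp: "\<lbrakk>x \<in> MO; y \<in> MO\<rbrakk>
    \<Longrightarrow> mcomp (comp_monfun M P G F) x y = ga (mcomp F x y) \<star> mcomp G (fo x) (fo y)"
  by (simp add: comp_monfun_def)

lemma comp_mid: "mid (comp_monfun M P G F) = ga (mid F) \<star> mid G"
  by (simp add: comp_monfun_def)

lemma comp_fobj: "x \<in> MO \<Longrightarrow> fobj (ufun (comp_monfun M P G F)) x = go (fo x)"
  by (simp add: comp_monfun_def comp_fctor_def compose_def)

lemma comp_farr: "f \<in> hom (ucat M) x y \<Longrightarrow> farr (ufun (comp_monfun M P G F)) f = ga (fa f)"
  by (simp add: comp_monfun_def comp_fctor_def compose_def hom_def)

text \<open>Interchange with the identity of \<open>u\<close> written as a composite of two
  identities; it splits the whiskered composite constraints.\<close>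

lemma tensor_Comp_Idt:
  "\<lbrakk>f \<in> hom (ucat P) x y; g \<in> hom (ucat P) y z; u \<in> Obj (ucat P)\<rbrakk>
    \<Longrightarrow> (g \<star> f) \<odot>\<^bsub>P\<^esub> IP u = (g \<odot>\<^bsub>P\<^esub> IP u) \<star> (f \<odot>\<^bsub>P\<^esub> IP u)"
  using G.N.tensor_Comp[of f x y g z "IP u" u u "IP u" u] G.N.U.Idt_hom[of u]
  by (simp add: G.N.U.Comp_Idt_hom)

lemma tensor_Idt_Comp:
  "\<lbrakk>f \<in> hom (ucat P) x y; g \<in> hom (ucat P) y z; u \<in> Obj (ucat P)\<rbrakk>
    \<Longrightarrow> IP u \<odot>\<^bsub>P\<^esub> (g \<star> f) = (IP u \<odot>\<^bsub>P\<^esub> g) \<star> (IP u \<odot>\<^bsub>P\<^esub> f)"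
  using G.N.tensor_Comp[of "IP u" u u "IP u" u f x y g z] G.N.U.Idt_hom[of u]
  by (simp add: G.N.U.Comp_Idt_hom)

text \<open>Naturality of the constraint of \<open>G\<close> at \<open>f\<close> paired with an
  identity, which \<open>ga\<close> preserves. It provides the commuting square for
  \<open>Comp_paste\<close>.\<close>

lemma natural_Idt_right:
  "\<lbrakk>f \<in> hom (ucat N) x y; z \<in> Obj (ucat N)\<rbrakk>
    \<Longrightarrow> mcomp G y z \<star> (ga f \<odot>\<^bsub>P\<^esub> IP (go z)) = ga (f \<odot>\<^bsub>N\<^esub> IN z) \<star> mcomp G x z"
  using G.mcomp_natural[of f x y "IN z" z z] F.N.U.Idt_hom[of z] by (simp add: G.ufun.farr_Idt)

lemma natural_Idt_left:
  "\<lbrakk>f \<in> hom (ucat N) x y; z \<in> Obj (ucat N)\<rbrakk>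
    \<Longrightarrow> mcomp G z y \<star> (IP (go z) \<odot>\<^bsub>P\<^esub> ga f) = ga (IN z \<odot>\<^bsub>N\<^esub> f) \<star> mcomp G z x"
  using G.mcomp_natural[of "IN z" z z f x y] F.N.U.Idt_hom[of z] by (simp add: G.ufun.farr_Idt)

lemma ga_Comp3:
  assumes "f \<in> hom (ucat N) w x" "g \<in> hom (ucat N) x y" "h \<in> hom (ucat N) y z"
  shows "ga (h \<cdot>\<^bsub>ucat N\<^esub> g \<cdot>\<^bsub>ucat N\<^esub> f) = ga h \<star> ga g \<star> ga f"
  using assms F.N.U.Comp_hom[OF assms(1,2)]
  by (simp add: G.ufun.farr_Comp_hom)

lemmas Objs = F.ufun.fobj_Obj G.ufun.fobj_Obj F.M.tensor_Obj F.N.tensor_Obj G.N.tensor_Obj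
  F.M.munit_closed F.N.munit_closed G.N.munit_closed

text \<open>Typing rules for repeated resolution: a goal about \<open>hom\<close> is taken apart
  along the structure of its term, and unknown endpoints are instantiated on the way.\<close>

lemmas homs = F_mcomp_hom G_mcomp_hom F_mid_hom G_mid_hom F.ufun.farr_hom G.ufun.farr_hom
  F.N.tensor_hom G.N.tensor_hom F.N.U.Idt_hom G.N.U.Idt_hom G.N.U.Comp_hom F.N.U.Comp_hom

text \<open>Two squares side by side: naturality of the constraint of \<open>G\<close> at the images
  under \<open>F\<close>, and the image under \<open>G\<close> of naturality for
  \<open>F\<close>.\<close>

lemma comp_natural:
  assumes f: "f \<in> hom (ucat M) x x'" and g: "g \<in> hom (ucat M) y y'"
  shows "(ga (mcomp F x' y') \<star> mcomp G (fo x') (fo y')) \<star> (ga (fa f) \<odot>\<^bsub>P\<^esub> ga (fa g))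
    = ga (fa (f \<odot>\<^bsub>M\<^esub> g)) \<star> ga (mcomp F x y) \<star> mcomp G (fo x) (fo y)"
proof -
  have o: "x \<in> MO" "x' \<in> MO" "y \<in> MO" "y' \<in> MO"
    using F.M.U.hom_Obj f g by auto
  note ff = F.ufun.farr_hom[OF f] and fg = F.ufun.farr_hom[OF g]
  note t = F.N.tensor_hom[OF ff fg]
  note tM = F.ufun.farr_hom[OF F.M.tensor_hom[OF f g]]
  have "(ga (mcomp F x' y') \<star> mcomp G (fo x') (fo y')) \<star> (ga (fa f) \<odot>\<^bsub>P\<^esub> ga (fa g))
      = ga (mcomp F x' y') \<star> mcomp G (fo x') (fo y') \<star> (ga (fa f) \<odot>\<^bsub>P\<^esub> ga (fa g))"
    by (rule G.N.U.Comp_assoc_hom) (rule homs Objs ff fg o)+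
  also have "\<dots> = ga (mcomp F x' y') \<star> ga (fa f \<odot>\<^bsub>N\<^esub> fa g) \<star> mcomp G (fo x) (fo y)"
    by (simp add: G.mcomp_natural[OF ff fg])
  also have "\<dots> = (ga (mcomp F x' y') \<star> ga (fa f \<odot>\<^bsub>N\<^esub> fa g)) \<star> mcomp G (fo x) (fo y)"
    by (rule G.N.U.Comp_assoc_hom[symmetric]) (rule homs Objs ff fg o)+
  also have "\<dots> = (ga (fa (f \<odot>\<^bsub>M\<^esub> g)) \<star> ga (mcomp F x y)) \<star> mcomp G (fo x) (fo y)"
    using F.mcomp_natural[OF f g] G.ufun.farr_Comp_hom[OF t F_mcomp_hom[OF o(2,4)]]
      G.ufun.farr_Comp_hom[OF F_mcomp_hom[OF o(1,3)] tM] by simp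
  also have "\<dots> = ga (fa (f \<odot>\<^bsub>M\<^esub> g)) \<star> ga (mcomp F x y) \<star> mcomp G (fo x) (fo y)"
    by (rule G.N.U.Comp_assoc_hom) (rule homs Objs tM o)+
  finally show ?thesis .
qed

text \<open>The diagram is tiled by the image under \<open>G\<close> of the condition for
  \<open>F\<close>, the condition for \<open>G\<close> at the images under \<open>F\<close>, and two
  naturality squares of the constraint of \<open>G\<close> that glue them to the whiskered
  constraints.\<close>

lemma comp_assoc:
  assumes o: "x \<in> MO" "y \<in> MO" "z \<in> MO"
  shows "ga (fa (massoc M x y z)) \<star> (ga (mcomp F (x \<otimes>\<^bsub>M\<^esub> y) z) \<star> mcomp G (fo (x \<otimes>\<^bsub>M\<^esub> y)) (fo z))
      \<star> ((ga (mcomp F x y) \<star> mcomp G (fo x) (fo y)) \<odot>\<^bsub>P\<^esub> IP (go (fo z)))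
    = (ga (mcomp F x (y \<otimes>\<^bsub>M\<^esub> z)) \<star> mcomp G (fo x) (fo (y \<otimes>\<^bsub>M\<^esub> z)))
      \<star> (IP (go (fo x)) \<odot>\<^bsub>P\<^esub> (ga (mcomp F y z) \<star> mcomp G (fo y) (fo z)))
      \<star> massoc P (go (fo x)) (go (fo y)) (go (fo z))" (is "?L = ?R")
proof -
  note aM = F.ufun.farr_hom[OF F.M.massoc_iso[OF o, THEN iso_hom_hom]]
  note fO = o[THEN F.ufun.fobj_Obj]
  note aN = F.N.massoc_iso[OF fO, THEN iso_hom_hom]
  note aP = G.N.massoc_iso[OF fO[THEN G.ufun.fobj_Obj], THEN iso_hom_hom]
  let ?X = "mcomp G (fo x) (fo y) \<odot>\<^bsub>P\<^esub> IP (go (fo z))"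
  let ?V' = "mcomp G (fo x \<otimes>\<^bsub>N\<^esub> fo y) (fo z)"
  let ?U = "ga (mcomp F x (y \<otimes>\<^bsub>M\<^esub> z))"
  let ?V = "mcomp G (fo x) (fo (y \<otimes>\<^bsub>M\<^esub> z))"
  let ?W = "ga (IN (fo x) \<odot>\<^bsub>N\<^esub> mcomp F y z)"
  let ?W' = "IP (go (fo x)) \<odot>\<^bsub>P\<^esub> ga (mcomp F y z)"
  let ?Y = "mcomp G (fo x) (fo y \<otimes>\<^bsub>N\<^esub> fo z)"
  let ?X' = "IP (go (fo x)) \<odot>\<^bsub>P\<^esub> mcomp G (fo y) (fo z)"
  let ?aN = "ga (massoc N (fo x) (fo y) (fo z))"
  let ?aP = "massoc P (go (fo x)) (go (fo y)) (go (fo z))"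
  have L: "(ga (mcomp F x y) \<star> mcomp G (fo x) (fo y)) \<odot>\<^bsub>P\<^esub> IP (go (fo z))
      = (ga (mcomp F x y) \<odot>\<^bsub>P\<^esub> IP (go (fo z))) \<star> ?X"
    by (rule tensor_Comp_Idt) (rule homs Objs o)+
  \<comment> \<open>The first naturality square moves the constraint of \<open>G\<close> past the
    image of \<open>mcomp F x y\<close>. Three images under \<open>ga\<close> become adjacent and
    form the image of one side of the condition for \<open>F\<close>.\<close>
  have "?L = (ga (fa (massoc M x y z)) \<star> ga (mcomp F (x \<otimes>\<^bsub>M\<^esub> y) z)
        \<star> ga (mcomp F x y \<odot>\<^bsub>N\<^esub> IN (fo z))) \<star> ?V' \<star> ?X"
    unfolding L
    by (rule G.N.U.Comp_paste) (rule natural_Idt_right homs Objs aM o)+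
  also have "ga (fa (massoc M x y z)) \<star> ga (mcomp F (x \<otimes>\<^bsub>M\<^esub> y) z)
        \<star> ga (mcomp F x y \<odot>\<^bsub>N\<^esub> IN (fo z)) = ga (fa (massoc M x y z) \<cdot>\<^bsub>ucat N\<^esub>
          mcomp F (x \<otimes>\<^bsub>M\<^esub> y) z \<cdot>\<^bsub>ucat N\<^esub> (mcomp F x y \<odot>\<^bsub>N\<^esub> IN (fo z)))"
    by (rule ga_Comp3[symmetric]) (rule homs Objs aM o)+
  also have "\<dots> = ga (mcomp F x (y \<otimes>\<^bsub>M\<^esub> z) \<cdot>\<^bsub>ucat N\<^esub> (IN (fo x) \<odot>\<^bsub>N\<^esub> mcomp F y z)
      \<cdot>\<^bsub>ucat N\<^esub> massoc N (fo x) (fo y) (fo z))"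
    by (simp add: F.mfun_assoc o)
  also have "\<dots> = ?U \<star> ?W \<star> ?aN"
    by (rule ga_Comp3) (rule homs Objs aN o)+
  \<comment> \<open>Regrouping brings the image of the associator of \<open>N\<close> next to the
    constraints of \<open>G\<close>, where it completes the left side of the condition for
    \<open>G\<close>.\<close>
  also have "(?U \<star> ?W \<star> ?aN) \<star> ?V' \<star> ?X = ((?U \<star> ?W) \<star> ?aN) \<star> ?V' \<star> ?X"
    by (subst G.N.U.Comp_assoc_hom) (rule homs Objs aN o refl)+
  also have "\<dots> = (?U \<star> ?W) \<star> ?aN \<star> ?V' \<star> ?X"
    by (rule G.N.U.Comp_assoc_hom) (rule homs Objs aN o)+
  also have "?aN \<star> ?V' \<star> ?X = ?Y \<star> ?X' \<star> ?aP"
    by (rule G.mfun_assoc) (rule fO)+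
  also have "(?U \<star> ?W) \<star> ?Y \<star> ?X' \<star> ?aP = ((?U \<star> ?W) \<star> ?Y) \<star> ?X' \<star> ?aP"
    by (rule G.N.U.Comp_assoc_hom[symmetric]) (rule homs Objs aP o)+
  also have "(?U \<star> ?W) \<star> ?Y = ?U \<star> ?W \<star> ?Y"
    by (rule G.N.U.Comp_assoc_hom) (rule homs Objs o)+
  \<comment> \<open>The second naturality square, read backwards. It puts \<open>?V\<close> next to
    \<open>?U\<close>, and \<open>?U \<star> ?V\<close> is the composite constraint required on the
    right; \<open>?W'\<close> and \<open>?X'\<close> then merge by interchange.\<close>
  also have "?W \<star> ?Y = ?V \<star> ?W'"
    by (rule natural_Idt_left[symmetric]) (rule homs Objs o)+
  also have "?U \<star> ?V \<star> ?W' = (?U \<star> ?V) \<star> ?W'"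
    by (rule G.N.U.Comp_assoc_hom[symmetric]) (rule homs Objs o)+
  also have "((?U \<star> ?V) \<star> ?W') \<star> ?X' \<star> ?aP = (?U \<star> ?V) \<star> ?W' \<star> ?X' \<star> ?aP"
    by (rule G.N.U.Comp_assoc_hom) (rule homs Objs aP o)+
  also have "?W' \<star> ?X' \<star> ?aP = (?W' \<star> ?X') \<star> ?aP"
    by (rule G.N.U.Comp_assoc_hom[symmetric]) (rule homs Objs aP o)+
  also have "?W' \<star> ?X' = IP (go (fo x)) \<odot>\<^bsub>P\<^esub> (ga (mcomp F y z) \<star> mcomp G (fo y) (fo z))"
    by (rule tensor_Idt_Comp[symmetric]) (rule homs Objs o)+
  finally show ?thesis .
qed

text \<open>The same pasting with \<open>mid F\<close> in place of \<open>mcomp F x y\<close>: the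
  unit condition for \<open>F\<close> collapses the three images to that of the unit constraint of
  \<open>N\<close>, and the unit condition for \<open>G\<close> finishes.\<close>

lemma comp_lunit:
  assumes o: "x \<in> MO"
  shows "ga (fa (mlunit M x)) \<star> (ga (mcomp F (munit M) x) \<star> mcomp G (fo (munit M)) (fo x))
      \<star> ((ga (mid F) \<star> mid G) \<odot>\<^bsub>P\<^esub> IP (go (fo x))) = mlunit P (go (fo x))" (is "?L = _")
proof -
  note lM = F.ufun.farr_hom[OF F.M.mlunit_iso[OF o, THEN iso_hom_hom]]
  let ?X = "mid G \<odot>\<^bsub>P\<^esub> IP (go (fo x))"
  have L: "(ga (mid F) \<star> mid G) \<odot>\<^bsub>P\<^esub> IP (go (fo x)) = (ga (mid F) \<odot>\<^bsub>P\<^esub> IP (go (fo x))) \<star> ?X"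
    by (rule tensor_Comp_Idt) (rule homs Objs o)+
  have "?L = (ga (fa (mlunit M x)) \<star> ga (mcomp F (munit M) x) \<star> ga (mid F \<odot>\<^bsub>N\<^esub> IN (fo x)))
      \<star> mcomp G (munit N) (fo x) \<star> ?X"
    unfolding L
    by (rule G.N.U.Comp_paste) (rule natural_Idt_right homs Objs lM o)+
  also have "ga (fa (mlunit M x)) \<star> ga (mcomp F (munit M) x) \<star> ga (mid F \<odot>\<^bsub>N\<^esub> IN (fo x))
      = ga (fa (mlunit M x) \<cdot>\<^bsub>ucat N\<^esub> mcomp F (munit M) x \<cdot>\<^bsub>ucat N\<^esub> (mid F \<odot>\<^bsub>N\<^esub> IN (fo x)))"
    by (rule ga_Comp3[symmetric]) (rule homs Objs lM o)+
  also have "\<dots> = ga (mlunit N (fo x))"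
    by (simp add: F.mfun_lunit o)
  also have "\<dots> \<star> mcomp G (munit N) (fo x) \<star> ?X = mlunit P (go (fo x))"
    by (rule G.mfun_lunit) (rule Objs o)+
  finally show ?thesis .
qed

text \<open>The mirror image, with the square taken from \<open>natural_Idt_left\<close>.\<close>

lemma comp_runit:
  assumes o: "x \<in> MO"
  shows "ga (fa (mrunit M x)) \<star> (ga (mcomp F x (munit M)) \<star> mcomp G (fo x) (fo (munit M)))
      \<star> (IP (go (fo x)) \<odot>\<^bsub>P\<^esub> (ga (mid F) \<star> mid G)) = mrunit P (go (fo x))" (is "?L = _")
proof -
  note rM = F.ufun.farr_hom[OF F.M.mrunit_iso[OF o, THEN iso_hom_hom]]
  let ?X = "IP (go (fo x)) \<odot>\<^bsub>P\<^esub> mid G"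
  have L: "IP (go (fo x)) \<odot>\<^bsub>P\<^esub> (ga (mid F) \<star> mid G) = (IP (go (fo x)) \<odot>\<^bsub>P\<^esub> ga (mid F)) \<star> ?X"
    by (rule tensor_Idt_Comp) (rule homs Objs o)+
  have "?L = (ga (fa (mrunit M x)) \<star> ga (mcomp F x (munit M)) \<star> ga (IN (fo x) \<odot>\<^bsub>N\<^esub> mid F))
      \<star> mcomp G (fo x) (munit N) \<star> ?X"
    unfolding L
    by (rule G.N.U.Comp_paste) (rule natural_Idt_left homs Objs rM o)+
  also have "ga (fa (mrunit M x)) \<star> ga (mcomp F x (munit M)) \<star> ga (IN (fo x) \<odot>\<^bsub>N\<^esub> mid F)
      = ga (fa (mrunit M x) \<cdot>\<^bsub>ucat N\<^esub> mcomp F x (munit M) \<cdot>\<^bsub>ucat N\<^esub> (IN (fo x) \<odot>\<^bsub>N\<^esub> mid F))"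
    by (rule ga_Comp3[symmetric]) (rule homs Objs rM o)+
  also have "\<dots> = ga (mrunit N (fo x))"
    by (simp add: F.mfun_runit o)
  also have "\<dots> \<star> mcomp G (fo x) (munit N) \<star> ?X = mrunit P (go (fo x))"
    by (rule G.mfun_runit) (rule Objs o)+
  finally show ?thesis .
qed

lemma comp_monoidal_functor: "monoidal_functor M P (comp_monfun M P G F)"
proof (intro monoidal_functor.intro)
  show "cat_functor (ucat M) (ucat P) (ufun (comp_monfun M P G F))"
    using comp_cat_functor[OF F.ufun.cat_functor_axioms G.ufun.cat_functor_axioms]
    by (simp add: comp_monfun_def)
  show "monoidal_functor_axioms M P (comp_monfun M P G F)"
  proof (rule monoidal_functor_axioms.intro, goal_cases)
    case (1 x y)
    then show ?case
      using G.N.U.Comp_iso_hom[OF G.mcomp_iso G.ufun.farr_iso_hom[OF F.mcomp_iso[OF 1]]]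
      by (simp add: comp_mcomp comp_fobj Objs)
  next
    case 2
    then show ?case
      using G.N.U.Comp_iso_hom[OF G.mid_iso G.ufun.farr_iso_hom[OF F.mid_iso]]
      by (simp add: comp_mid comp_fobj Objs)
  next
    case (3 f x x' g y y')
    then show ?case
      using comp_natural[OF 3] F.M.U.hom_Obj[OF 3(1)] F.M.U.hom_Obj[OF 3(2)]
      by (simp add: comp_mcomp comp_farr[OF 3(1)] comp_farr[OF 3(2)]
          comp_farr[OF F.M.tensor_hom[OF 3]])
  next
    case (4 x y z)
    then show ?case
      using comp_assoc[OF 4] comp_farr[OF F.M.massoc_iso[OF 4, THEN iso_hom_hom]]
      by (simp add: comp_mcomp comp_fobj Objs)
  next
    case (5 x)
    then show ?case
      using comp_lunit[OF 5] comp_farr[OF F.M.mlunit_iso[OF 5, THEN iso_hom_hom]]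
      by (simp add: comp_mcomp comp_mid comp_fobj Objs)
  next
    case (6 x)
    then show ?case
      using comp_runit[OF 6] comp_farr[OF F.M.mrunit_iso[OF 6, THEN iso_hom_hom]]
      by (simp add: comp_mcomp comp_mid comp_fobj Objs)
  qed (auto simp: comp_monfun_def)
qed (fact F.M.monoidal_category_axioms G.N.monoidal_category_axioms)+

end

section \<open>Unit and associativity laws for monoidal functors, and their category\<close>

context monoidal_functor
begin

text \<open>The identity constraints go to identities under \<open>F\<close> and are absorbed;
  \<open>mcomp_undefined\<close> settles the arguments that are not objects.\<close>

lemma comp_id_monfun: "comp_monfun M N F (id_monfun M) = F"
proof (rule monfun.equality)
  show "ufun (comp_monfun M N F (id_monfun M)) = ufun F"
    by (simp add: comp_monfun_def id_monfun_def ufun.comp_id_fctor)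
  have "farr (ufun F) (Idt (ucat M) (x \<otimes>\<^bsub>M\<^esub> y)) \<cdot>\<^bsub>ucat N\<^esub> mcomp F x y = mcomp F x y"
    if "x \<in> Obj (ucat M)" "y \<in> Obj (ucat M)" for x y
    using N.U.Idt_Comp_hom[OF mcomp_iso[OF that, THEN iso_hom_hom]]
    by (simp add: ufun.farr_Idt M.tensor_Obj that)
  then show "mcomp (comp_monfun M N F (id_monfun M)) = mcomp F"
    by (auto simp: fun_eq_iff comp_monfun_def id_monfun_def id_fctor_def mcomp_undefined)
  show "mid (comp_monfun M N F (id_monfun M)) = mid F"
    using N.U.Idt_Comp_hom[OF mid_iso[THEN iso_hom_hom]]
    by (simp add: comp_monfun_def id_monfun_def ufun.farr_Idt M.munit_closed)
qed simp

lemma id_comp_monfun: "comp_monfun M N (id_monfun N) F = F"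
proof (rule monfun.equality)
  have arr: "f \<in> hom (ucat N) x y \<Longrightarrow> f \<in> Arr (ucat N)" for f x y
    by (simp add: hom_def)
  show "ufun (comp_monfun M N (id_monfun N) F) = ufun F"
    by (simp add: comp_monfun_def id_monfun_def ufun.id_comp_fctor)
  have "mcomp (comp_monfun M N (id_monfun N) F) x y = mcomp F x y" for x y
  proof (cases "x \<in> Obj (ucat M) \<and> y \<in> Obj (ucat M)")
    case True
    then have "mcomp F x y \<in> hom (ucat N)
        (fobj (ufun F) x \<otimes>\<^bsub>N\<^esub> fobj (ufun F) y) (fobj (ufun F) (x \<otimes>\<^bsub>M\<^esub> y))"
      by (simp add: mcomp_iso iso_hom_hom)
    with True show ?thesis
      by (simp add: comp_monfun_def id_monfun_def id_fctor_def ufun.fobj_Obj arr N.U.Comp_Idt_hom)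
  qed (auto simp: comp_monfun_def mcomp_undefined)
  then show "mcomp (comp_monfun M N (id_monfun N) F) = mcomp F"
    by (simp add: fun_eq_iff)
  show "mid (comp_monfun M N (id_monfun N) F) = mid F"
    using mid_iso[THEN iso_hom_hom]
    by (simp add: comp_monfun_def id_monfun_def id_fctor_def arr N.U.Comp_Idt_hom)
qed simp

end

text \<open>Either bracketing gives a composite of three factors: the constraint of \<open>F\<close>
  mapped by \<open>G\<close> and \<open>H\<close>, that of \<open>G\<close> mapped by
  \<open>H\<close>, and that of \<open>H\<close>. Functoriality of \<open>H\<close> splits one side,
  and associativity in \<open>Q\<close> does the rest.\<close>

lemma comp_monfun_assoc:
  assumes "monoidal_functor M N F" "monoidal_functor N P G" "monoidal_functor P Q H"
  shows "comp_monfun M Q (comp_monfun N Q H G) F = comp_monfun M Q H (comp_monfun M P G F)"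
proof (rule monfun.equality)
  interpret F: monoidal_functor M N F by fact
  interpret G: monoidal_functor N P G by fact
  interpret H: monoidal_functor P Q H by fact
  have arr: "f \<in> hom (ucat N) x y \<Longrightarrow> f \<in> Arr (ucat N)" for f x y
    by (simp add: hom_def)
  show "ufun (comp_monfun M Q (comp_monfun N Q H G) F)
      = ufun (comp_monfun M Q H (comp_monfun M P G F))"
    by (simp add: comp_monfun_def F.ufun.comp_fctor_assoc)
  have "mcomp (comp_monfun M Q (comp_monfun N Q H G) F) x y
      = mcomp (comp_monfun M Q H (comp_monfun M P G F)) x y" for x y
  proof (cases "x \<in> Obj (ucat M) \<and> y \<in> Obj (ucat M)")
    case True
    let ?x = "fobj (ufun F) x" and ?y = "fobj (ufun F) y"
    from True have o: "?x \<in> Obj (ucat N)" "?y \<in> Obj (ucat N)"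
      "fobj (ufun G) ?x \<in> Obj (ucat P)" "fobj (ufun G) ?y \<in> Obj (ucat P)"
      by (simp_all add: F.ufun.fobj_Obj G.ufun.fobj_Obj)
    from True have f: "mcomp F x y \<in> hom (ucat N) (?x \<otimes>\<^bsub>N\<^esub> ?y) (fobj (ufun F) (x \<otimes>\<^bsub>M\<^esub> y))"
      by (simp add: F.mcomp_iso iso_hom_hom)
    note g = G.mcomp_iso[OF o(1,2), THEN iso_hom_hom] and gf = G.ufun.farr_hom[OF f]
    note h = H.mcomp_iso[OF o(3,4), THEN iso_hom_hom]
    show ?thesis
      using True o H.N.U.Comp_assoc_hom[OF h H.ufun.farr_hom[OF g] H.ufun.farr_hom[OF gf]]
      by (simp add: comp_monfun_def comp_fctor_def compose_def arr[OF f]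
          H.ufun.farr_Comp_hom[OF g gf])
  qed (auto simp: comp_monfun_def)
  then show "mcomp (comp_monfun M Q (comp_monfun N Q H G) F)
      = mcomp (comp_monfun M Q H (comp_monfun M P G F))"
    by (simp add: fun_eq_iff)
  note f = F.mid_iso[THEN iso_hom_hom] and g = G.mid_iso[THEN iso_hom_hom]
    and h = H.mid_iso[THEN iso_hom_hom]
  note gf = G.ufun.farr_hom[OF f]
  show "mid (comp_monfun M Q (comp_monfun N Q H G) F)
      = mid (comp_monfun M Q H (comp_monfun M P G F))"
    using H.N.U.Comp_assoc_hom[OF h H.ufun.farr_hom[OF g] H.ufun.farr_hom[OF gf]]
    by (simp add: comp_monfun_def comp_fctor_def compose_def arr[OF f]
        H.ufun.farr_Comp_hom[OF g gf])
qed simp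

lemma monoidal_functor_comp:
  "\<lbrakk>monoidal_functor M N F; monoidal_functor N P G\<rbrakk>
    \<Longrightarrow> monoidal_functor M P (comp_monfun M P G F)"
  by (rule monoidal_functor_pair.comp_monoidal_functor[OF monoidal_functor_pair.intro])

lemma monarrs_iff: "(M, F, N) \<in> monarrs \<longleftrightarrow> monoidal_functor M N F"
  by (simp add: monarrs_def)

text \<open>Endpoints are components of the triples, so the laws for \<open>Dom\<close> and
  \<open>Cod\<close> are immediate. The substance is closure under composition and the strict unit
  and associativity laws above.\<close>

lemma category_MonCat1: "category (MonCat1 :: (('o, 'm) moncat, ('o, 'm) monarr) cat)"
proof (rule category.intro, goal_cases)
  case 1
  then show ?case
    by (auto simp: MonCat1_def monarrs_def monoidal_functor_def)
next
  case 2
  then show ?case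
    by (auto simp: MonCat1_def monarrs_def monoidal_functor_def)
next
  case 3
  then show ?case
    by (auto simp: MonCat1_def monarrs_iff monoidal_category.id_monoidal_functor)
next
  case (4 M)
  then show ?case
    by (auto simp: MonCat1_def monarrs_iff monoidal_category.id_monoidal_functor)
next
  case (5 M)
  then show ?case
    by (auto simp: MonCat1_def monarrs_iff monoidal_category.id_monoidal_functor)
next
  case (6 f g)
  then show ?case
    by (cases f; cases g) (auto simp: MonCat1_def monarrs_iff monoidal_functor_comp)
next
  case (7 f g)
  then show ?case
    by (cases f; cases g) (auto simp: MonCat1_def monarrs_iff monoidal_functor_comp)
next
  case (8 f g)
  then show ?case
    by (cases f; cases g) (auto simp: MonCat1_def monarrs_iff monoidal_functor_comp)
next
  case (9 f g)
  then show ?case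
    by (cases f; cases g) (auto simp: MonCat1_def)
next
  case (10 f)
  then show ?case
    by (cases f) (auto simp: MonCat1_def monarrs_iff monoidal_functor.comp_id_monfun
        monoidal_category.id_monoidal_functor monoidal_functor.axioms(1,2))
next
  case (11 f)
  then show ?case
    by (cases f) (auto simp: MonCat1_def monarrs_iff monoidal_functor.id_comp_monfun
        monoidal_category.id_monoidal_functor monoidal_functor.axioms(1,2))
next
  case (12 f g h)
  then show ?case
    by (cases f; cases g; cases h)
      (auto simp: MonCat1_def monarrs_iff monoidal_functor_comp comp_monfun_assoc)
qed

section \<open>Degenerate bicategories\<close>

text \<open>The inverse of \<open>xi_obj\<close>. Only the 0-cell indices are tested: at arguments
  that are not objects the constraints of a monoidal category are already
  \<open>undefined\<close>.\<close>

definition moncat_bicat :: "'z \<Rightarrow> ('o, 'm) moncat \<Rightarrow> ('z, 'o, 'm) bicat" where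
  "moncat_bicat pt M =
    \<lparr>Cells0 = {pt},
     Homc = (\<lambda>a b. if a = pt \<and> b = pt then ucat M else undefined),
     hcomp = (\<lambda>a b c. if a = pt \<and> b = pt \<and> c = pt then tensor M else undefined),
     unit1 = (\<lambda>a. if a = pt then munit M else undefined),
     bassoc = (\<lambda>a b c d h g f.
       if a = pt \<and> b = pt \<and> c = pt \<and> d = pt then massoc M h g f else undefined),
     blunit = (\<lambda>a b f. if a = pt \<and> b = pt then mlunit M f else undefined),
     brunit = (\<lambda>a b f. if a = pt \<and> b = pt then mrunit M f else undefined)\<rparr>"

definition monfun_wfun :: "'z \<Rightarrow> ('o, 'm, 'p, 'n) monfun \<Rightarrow> ('z, 'o, 'm, 'z, 'p, 'n) wfun" where
  "monfun_wfun pt F =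
    \<lparr>wmap = (\<lambda>a \<in> {pt}. pt),
     whom = (\<lambda>a b. if a = pt \<and> b = pt then ufun F else undefined),
     wcomp = (\<lambda>a b c g f. if a = pt \<and> b = pt \<and> c = pt then mcomp F g f else undefined),
     wunit = (\<lambda>a. if a = pt then mid F else undefined)\<rparr>"

lemma xi_obj_moncat_bicat: "xi_obj pt (moncat_bicat pt M) = M"
  by (simp add: xi_obj_def moncat_bicat_def)

lemma xi_fun_monfun_wfun: "xi_fun pt (monfun_wfun pt F) = F"
  by (simp add: xi_fun_def monfun_wfun_def)

text \<open>The \<open>undefined\<close> axioms of a bicategory enter here: they fix every field
  away from \<open>pt\<close>, so that equality holds between whole records.\<close>

lemma moncat_bicat_xi_obj:
  assumes "degenerate_bicategory pt B"
  shows "moncat_bicat pt (xi_obj pt B) = B" (is "?B = B")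
proof -
  interpret bicategory B
    using assms by (simp add: degenerate_bicategory_def)
  have pt: "Cells0 B = {pt}"
    using assms by (simp add: degenerate_bicategory_def)
  note defs = moncat_bicat_def xi_obj_def pt
  have "Homc ?B a b = Homc B a b" for a b
    using Homc_undefined[of a b] by (auto simp: defs)
  moreover have "hcomp ?B a b c = hcomp B a b c" for a b c
    using hcomp_undefined[of a b c] by (auto simp: defs)
  moreover have "unit1 ?B a = unit1 B a" for a
    using unit1_undefined[of a] by (auto simp: defs)
  moreover have "bassoc ?B a b c d h g f = bassoc B a b c d h g f" for a b c d h g f
    using bassoc_undefined[of a b c d h g f] by (auto simp: defs)
  moreover have "blunit ?B a b f = blunit B a b f" for a b f
    using blunit_undefined[of a b f] by (auto simp: defs)
  moreover have "brunit ?B a b f = brunit B a b f" for a b f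
    using brunit_undefined[of a b f] by (auto simp: defs)
  ultimately show ?thesis
    by (intro bicat.equality ext) (simp_all add: moncat_bicat_def pt)
qed

lemma monfun_wfun_xi_fun:
  assumes "degenerate_bicategory pt B" "degenerate_bicategory pt C" "weak_functor B C F"
  shows "monfun_wfun pt (xi_fun pt F) = F" (is "?F = F")
proof -
  interpret weak_functor B C F by fact
  have pt: "Cells0 B = {pt}" "Cells0 C = {pt}"
    using assms by (simp_all add: degenerate_bicategory_def)
  note defs = monfun_wfun_def xi_fun_def pt
  \<comment> \<open>The map on 0-cells is forced: at \<open>pt\<close> the only possible value is
    \<open>pt\<close>, and elsewhere extensionality gives \<open>undefined\<close>.\<close>
  have "wmap ?F a = wmap F a" for a
    using PiE_mem[OF wmap_closed, of a] PiE_arb[OF wmap_closed, of a] by (auto simp: defs)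
  moreover have "whom ?F a b = whom F a b" for a b
    using whom_undefined[of a b] by (auto simp: defs)
  moreover have "wcomp ?F a b c g f = wcomp F a b c g f" for a b c g f
    using wcomp_undefined[of a b c g f] by (auto simp: defs)
  moreover have "wunit ?F a = wunit F a" for a
    using wunit_undefined[of a] by (auto simp: defs)
  ultimately show ?thesis
    by (intro wfun.equality ext) simp_all
qed

section \<open>Both passages preserve the axioms\<close>

lemma monoidal_category_xi_obj:
  assumes "degenerate_bicategory pt B"
  shows "monoidal_category (xi_obj pt B)"
proof -
  interpret bicategory B
    using assms by (simp add: degenerate_bicategory_def)
  have pt: "pt \<in> Cells0 B"
    using assms by (simp add: degenerate_bicategory_def)
  have arb: "bassoc B pt pt pt pt h g f = undefined"
    if "\<not> (h \<in> cells1 B pt pt \<and> g \<in> cells1 B pt pt \<and> f \<in> cells1 B pt pt)" for h g f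
    using that by (intro bassoc_undefined) auto
  show ?thesis
    by (intro monoidal_category.intro monoidal_category_axioms.intro)
      (simp_all add: xi_obj_def pt Homc_category hcomp_functor unit1_closed bassoc_iso blunit_iso
        brunit_iso bassoc_natural blunit_natural brunit_natural bpentagon btriangle
        arb blunit_undefined brunit_undefined)
qed

lemma degenerate_bicategory_moncat_bicat:
  assumes "monoidal_category M"
  shows "degenerate_bicategory pt (moncat_bicat pt M)"
proof -
  interpret monoidal_category M by fact
  have "bicategory (moncat_bicat pt M)"
    by (rule bicategory.intro)
      (auto simp: moncat_bicat_def U.category_axioms tensor.cat_functor_axioms munit_closed
        massoc_iso mlunit_iso mrunit_iso massoc_natural mlunit_natural mrunit_natural
        pentagon triangle massoc_undefined mlunit_undefined mrunit_undefined)
  then show ?thesis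
    by (simp add: degenerate_bicategory_def moncat_bicat_def)
qed

lemma monoidal_functor_xi_fun:
  assumes "degenerate_bicategory pt B" "degenerate_bicategory pt C" "weak_functor B C F"
  shows "monoidal_functor (xi_obj pt B) (xi_obj pt C) (xi_fun pt F)"
proof -
  interpret weak_functor B C F by fact
  \<comment> \<open>Once \<open>wmap F pt\<close> is \<open>pt\<close>, all hom-categories of
    \<open>C\<close> named in the weak functor axioms are the one that \<open>xi_obj\<close>
    selects.\<close>
  have pt: "pt \<in> Cells0 B" "wmap F pt = pt"
    using assms wmap_closed by (auto simp: degenerate_bicategory_def)
  show ?thesis
    using monoidal_category_xi_obj[OF assms(1)] monoidal_category_xi_obj[OF assms(2)]
      whom_functor[OF pt(1) pt(1)]
      wcomp_iso[OF pt(1) pt(1) pt(1)] wunit_iso[OF pt(1)] wcomp_natural[OF pt(1) pt(1) pt(1)]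
      wfun_assoc[OF pt(1) pt(1) pt(1) pt(1)] wfun_lunit[OF pt(1) pt(1)] wfun_runit[OF pt(1) pt(1)]
      wcomp_undefined[of pt pt pt]
    by (intro monoidal_functor.intro monoidal_functor_axioms.intro)
      (simp_all add: xi_obj_def xi_fun_def pt)
qed

lemma weak_functor_monfun_wfun:
  assumes "monoidal_functor M N F"
  shows "weak_functor (moncat_bicat pt M) (moncat_bicat pt N) (monfun_wfun pt F)"
proof -
  interpret monoidal_functor M N F by fact
  show ?thesis
    using degenerate_bicategory_moncat_bicat[OF M.monoidal_category_axioms, of pt]
      degenerate_bicategory_moncat_bicat[OF N.monoidal_category_axioms, of pt]
    by (intro weak_functor.intro weak_functor_axioms.intro)
      (auto simp: degenerate_bicategory_def moncat_bicat_def monfun_wfun_def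
        ufun.cat_functor_axioms mcomp_iso mid_iso mcomp_natural mfun_assoc mfun_lunit mfun_runit
        mcomp_undefined)
qed

section \<open>Identities and composites of weak functors\<close>

lemma weak_functor_wmap:
  assumes "degenerate_bicategory pt B" "degenerate_bicategory pt C" "weak_functor B C F"
  shows "wmap F pt = pt"
  using weak_functor.wmap_closed[OF assms(3)] assms(1,2) by (auto simp: degenerate_bicategory_def)

lemma id_wfun_eq:
  assumes "degenerate_bicategory pt B"
  shows "id_wfun B = monfun_wfun pt (id_monfun (xi_obj pt B))"
  using assms
  by (intro wfun.equality ext)
    (auto simp: id_wfun_def id_monfun_def monfun_wfun_def xi_obj_def degenerate_bicategory_def)

text \<open>At \<open>pt\<close> the two composition formulas agree literally, and away from it both
  sides are \<open>undefined\<close>.\<close>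

lemma comp_wfun_eq:
  assumes "degenerate_bicategory pt B" "degenerate_bicategory pt C" "degenerate_bicategory pt D"
    and F: "weak_functor B C F" and G: "weak_functor C D G"
  shows "comp_wfun B D G F
    = monfun_wfun pt (comp_monfun (xi_obj pt B) (xi_obj pt D) (xi_fun pt G) (xi_fun pt F))"
proof -
  have pt: "Cells0 B = {pt}" "wmap F pt = pt" "wmap G pt = pt"
    using assms(1) weak_functor_wmap[OF assms(1,2) F] weak_functor_wmap[OF assms(2,3) G]
    by (simp_all add: degenerate_bicategory_def)
  show ?thesis
    by (intro wfun.equality ext)
      (auto simp: comp_wfun_def comp_monfun_def monfun_wfun_def xi_obj_def xi_fun_def pt compose_def)
qed

lemma xi_fun_id_wfun:
  "degenerate_bicategory pt B \<Longrightarrow> xi_fun pt (id_wfun B) = id_monfun (xi_obj pt B)"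
  by (simp add: id_wfun_eq xi_fun_monfun_wfun)

lemma xi_fun_comp_wfun:
  "\<lbrakk>degenerate_bicategory pt B; degenerate_bicategory pt C; degenerate_bicategory pt D;
    weak_functor B C F; weak_functor C D G\<rbrakk>
    \<Longrightarrow> xi_fun pt (comp_wfun B D G F)
      = comp_monfun (xi_obj pt B) (xi_obj pt D) (xi_fun pt G) (xi_fun pt F)"
  by (simp add: comp_wfun_eq xi_fun_monfun_wfun)

lemma weak_functor_id_wfun:
  assumes "degenerate_bicategory pt B"
  shows "weak_functor B B (id_wfun B)"
  using weak_functor_monfun_wfun[OF monoidal_category.id_monoidal_functor
      [OF monoidal_category_xi_obj[OF assms]], of pt]
  by (simp add: moncat_bicat_xi_obj[OF assms] id_wfun_eq[OF assms])

text \<open>No pasting on the bicategorical side: the composite is formed among monoidal functors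
  and carried back, and \<open>moncat_bicat_xi_obj\<close> restores its source and target.\<close>

lemma weak_functor_comp_wfun:
  assumes "degenerate_bicategory pt B" "degenerate_bicategory pt C" "degenerate_bicategory pt D"
    and "weak_functor B C F" "weak_functor C D G"
  shows "weak_functor B D (comp_wfun B D G F)"
  using weak_functor_monfun_wfun[OF monoidal_functor_comp
      [OF monoidal_functor_xi_fun[OF assms(1,2,4)] monoidal_functor_xi_fun[OF assms(2,3,5)]], of pt]
  by (simp add: moncat_bicat_xi_obj assms(1,3) comp_wfun_eq[OF assms])

section \<open>Transport of category structure along a bijection\<close>

text \<open>\<open>A\<close> brings only data, closure and default values. Its equational laws are
  pulled back from \<open>B\<close> along the injective \<open>F\<close>; extensionality makes
  \<open>F\<close> itself a functor in the strict sense.\<close>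

locale transported_category = B: category B
  for B :: "('p, 'n) cat" +
  fixes A :: "('o, 'm) cat" and F :: "('o, 'm, 'p, 'n) fctor"
  assumes fobj_bij: "bij_betw (fobj F) (Obj A) (Obj B)"
    and farr_bij: "bij_betw (farr F) (Arr A) (Arr B)"
    and fobj_ext: "fobj F \<in> extensional (Obj A)"
    and farr_ext: "farr F \<in> extensional (Arr A)"
    and Dom: "Dom A \<in> Arr A \<rightarrow>\<^sub>E Obj A"
    and Cod: "Cod A \<in> Arr A \<rightarrow>\<^sub>E Obj A"
    and Idt: "Idt A \<in> Obj A \<rightarrow>\<^sub>E Arr A"
    and Comp: "\<lbrakk>f \<in> Arr A; g \<in> Arr A; Dom A g = Cod A f\<rbrakk> \<Longrightarrow> g \<cdot>\<^bsub>A\<^esub> f \<in> Arr A"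
    and Comp_arb: "\<not> (f \<in> Arr A \<and> g \<in> Arr A \<and> Dom A g = Cod A f) \<Longrightarrow> g \<cdot>\<^bsub>A\<^esub> f = undefined"
    and F_Dom: "f \<in> Arr A \<Longrightarrow> Dom B (farr F f) = fobj F (Dom A f)"
    and F_Cod: "f \<in> Arr A \<Longrightarrow> Cod B (farr F f) = fobj F (Cod A f)"
    and F_Idt: "x \<in> Obj A \<Longrightarrow> farr F (Idt A x) = Idt B (fobj F x)"
    and F_Comp: "\<lbrakk>f \<in> Arr A; g \<in> Arr A; Dom A g = Cod A f\<rbrakk>
      \<Longrightarrow> farr F (g \<cdot>\<^bsub>A\<^esub> f) = farr F g \<cdot>\<^bsub>B\<^esub> farr F f"
begin

lemma Obj_eqI: "\<lbrakk>fobj F x = fobj F y; x \<in> Obj A; y \<in> Obj A\<rbrakk> \<Longrightarrow> x = y"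
  using fobj_bij by (auto simp: bij_betw_def inj_on_def)

lemma Arr_eqI: "\<lbrakk>farr F f = farr F g; f \<in> Arr A; g \<in> Arr A\<rbrakk> \<Longrightarrow> f = g"
  using farr_bij by (auto simp: bij_betw_def inj_on_def)

lemma F_Obj: "x \<in> Obj A \<Longrightarrow> fobj F x \<in> Obj B"
  using fobj_bij by (auto simp: bij_betw_def)

lemma F_Arr: "f \<in> Arr A \<Longrightarrow> farr F f \<in> Arr B"
  using farr_bij by (auto simp: bij_betw_def)

lemma Dom_Obj: "f \<in> Arr A \<Longrightarrow> Dom A f \<in> Obj A"
  using Dom by auto

lemma Cod_Obj: "f \<in> Arr A \<Longrightarrow> Cod A f \<in> Obj A"
  using Cod by auto

lemma Idt_Arr: "x \<in> Obj A \<Longrightarrow> Idt A x \<in> Arr A"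
  using Idt by auto

text \<open>The pattern for all laws of \<open>A\<close>: apply \<open>F\<close> to both sides,
  compute in \<open>B\<close>, and cancel \<open>F\<close> by injectivity.\<close>

lemma Dom_Idt: "x \<in> Obj A \<Longrightarrow> Dom A (Idt A x) = x"
  by (rule Obj_eqI) (simp_all add: F_Dom[symmetric] F_Idt Idt_Arr F_Obj B.Dom_Idt Dom_Obj)

lemma Cod_Idt: "x \<in> Obj A \<Longrightarrow> Cod A (Idt A x) = x"
  by (rule Obj_eqI) (simp_all add: F_Cod[symmetric] F_Idt Idt_Arr F_Obj B.Cod_Idt Cod_Obj)

lemma F_composable: "\<lbrakk>f \<in> Arr A; g \<in> Arr A; Dom A g = Cod A f\<rbrakk>
    \<Longrightarrow> Dom B (farr F g) = Cod B (farr F f)"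
  by (simp add: F_Dom F_Cod)

lemma Dom_Comp: "\<lbrakk>f \<in> Arr A; g \<in> Arr A; Dom A g = Cod A f\<rbrakk> \<Longrightarrow> Dom A (g \<cdot>\<^bsub>A\<^esub> f) = Dom A f"
  by (rule Obj_eqI)
    (simp_all add: F_Dom[symmetric] F_Comp Comp F_Arr B.Dom_Comp F_composable Dom_Obj)

lemma Cod_Comp: "\<lbrakk>f \<in> Arr A; g \<in> Arr A; Dom A g = Cod A f\<rbrakk> \<Longrightarrow> Cod A (g \<cdot>\<^bsub>A\<^esub> f) = Cod A g"
  by (rule Obj_eqI)
    (simp_all add: F_Cod[symmetric] F_Comp Comp F_Arr B.Cod_Comp F_composable Cod_Obj)

sublocale A: category A
proof (rule category.intro, goal_cases)
  \<comment> \<open>Cases 10 to 12 are the two unit laws and associativity; the others are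
    assumptions or lemmas already shown.\<close>
  case (10 f)
  then show ?case
    by (intro Arr_eqI)
      (simp_all add: F_Comp F_Idt F_Arr Dom_Obj Idt_Arr Cod_Idt Comp F_Dom[symmetric]
        B.Comp_Idt_right)
next
  case (11 f)
  then show ?case
    by (intro Arr_eqI)
      (simp_all add: F_Comp F_Idt F_Arr Cod_Obj Idt_Arr Dom_Idt Comp F_Cod[symmetric]
        B.Comp_Idt_left)
next
  case (12 f g h)
  then show ?case
    by (intro Arr_eqI)
      (simp_all add: F_Comp F_Arr Comp Dom_Comp Cod_Comp B.Comp_assoc F_composable)
qed (fact Dom Cod Idt | rule Dom_Idt Cod_Idt Comp Dom_Comp Cod_Comp Comp_arb; assumption)+

sublocale cat_functor A B F
  using F_Obj F_Arr fobj_ext farr_ext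
  by unfold_locales (auto simp: F_Dom F_Cod F_Idt F_Comp PiE_def)

text \<open>The restriction to the carriers of \<open>B\<close> supplies the
  \<open>undefined\<close> values of a functor; outside the image of \<open>F\<close>,
  \<open>inv_into\<close> is unspecified.\<close>

definition inverse_fctor :: "('p, 'n, 'o, 'm) fctor" where
  "inverse_fctor =
    \<lparr>fobj = (\<lambda>y \<in> Obj B. inv_into (Obj A) (fobj F) y),
     farr = (\<lambda>g \<in> Arr B. inv_into (Arr A) (farr F) g)\<rparr>"

lemma inverse_fobj: "x \<in> Obj A \<Longrightarrow> fobj inverse_fctor (fobj F x) = x"
  using fobj_bij by (simp add: inverse_fctor_def F_Obj bij_betw_def)

lemma inverse_farr: "f \<in> Arr A \<Longrightarrow> farr inverse_fctor (farr F f) = f"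
  using farr_bij by (simp add: inverse_fctor_def F_Arr bij_betw_def)

lemma fobj_surj: "y \<in> Obj B \<Longrightarrow> \<exists>x \<in> Obj A. y = fobj F x"
  using fobj_bij by (auto simp: bij_betw_def)

lemma farr_surj: "g \<in> Arr B \<Longrightarrow> \<exists>f \<in> Arr A. g = farr F f"
  using farr_bij by (auto simp: bij_betw_def)

lemma inverse_cat_functor: "cat_functor B A inverse_fctor"
proof (intro cat_functor.intro cat_functor_axioms.intro)
  show "fobj inverse_fctor \<in> Obj B \<rightarrow>\<^sub>E Obj A"
    by (auto simp: inverse_fobj dest!: fobj_surj) (simp add: inverse_fctor_def)
  show "farr inverse_fctor \<in> Arr B \<rightarrow>\<^sub>E Arr A"
    by (auto simp: inverse_farr dest!: farr_surj) (simp add: inverse_fctor_def)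
  show "Dom A (farr inverse_fctor g) = fobj inverse_fctor (Dom B g)" if "g \<in> Arr B" for g
    using farr_surj[OF that] by (auto simp: inverse_farr inverse_fobj F_Dom Dom_Obj)
  show "Cod A (farr inverse_fctor g) = fobj inverse_fctor (Cod B g)" if "g \<in> Arr B" for g
    using farr_surj[OF that] by (auto simp: inverse_farr inverse_fobj F_Cod Cod_Obj)
  show "farr inverse_fctor (Idt B y) = Idt A (fobj inverse_fctor y)" if "y \<in> Obj B" for y
    using fobj_surj[OF that] by (auto simp: inverse_farr inverse_fobj F_Idt[symmetric] Idt_Arr)
  show "farr inverse_fctor (k \<cdot>\<^bsub>B\<^esub> g) = farr inverse_fctor k \<cdot>\<^bsub>A\<^esub> farr inverse_fctor g"
    if gk: "g \<in> Arr B" "k \<in> Arr B" "Dom B k = Cod B g" for g k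
  proof -
    obtain f h where fh: "f \<in> Arr A" "h \<in> Arr A" "g = farr F f" "k = farr F h"
      using farr_surj gk by blast
    \<comment> \<open>Composability in \<open>B\<close> is reflected to \<open>A\<close> because
      \<open>F\<close> is injective on objects.\<close>
    have "Dom A h = Cod A f"
      using gk(3) fh by (intro Obj_eqI) (simp_all add: F_Dom F_Cod Dom_Obj Cod_Obj)
    then show ?thesis
      using fh by (simp add: F_Comp[symmetric] inverse_farr Comp)
  qed
qed (fact A.category_axioms B.category_axioms)+

lemma inverse_comp: "comp_fctor A inverse_fctor F = id_fctor A"
  by (rule fctor.equality)
    (auto simp: comp_fctor_def id_fctor_def compose_def fun_eq_iff inverse_fobj inverse_farr)

lemma comp_inverse: "comp_fctor B F inverse_fctor = id_fctor B"
  by (rule fctor.equality)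
    (auto simp: comp_fctor_def id_fctor_def compose_def fun_eq_iff inverse_fobj inverse_farr
      dest!: fobj_surj farr_surj)

end

lemma (in category) id_natural_iso: "natural_iso C C (id_fctor C) (id_fctor C) (Idt C)"
  by (intro natural_iso.intro natural_iso_axioms.intro id_cat_functor category_axioms)
    (simp_all add: id_fctor_def Idt_iso_hom Comp_Idt_left Comp_Idt_right)

text \<open>\<open>F\<close> is an isomorphism of categories: both composites equal identity
  functors, so identity arrows serve as components of unit and counit.\<close>

lemma (in transported_category) equivalence: "equivalence_of_categories A B F"
  unfolding equivalence_of_categories_def
  using inverse_cat_functor A.id_natural_iso B.id_natural_iso cat_functor_axioms
  by (intro conjI exI[of _ inverse_fctor]) (auto simp: inverse_comp comp_inverse)

section \<open>The comparison functor\<close>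

lemma degenerate_biarrs_iff:
  "(B, F, C) \<in> degenerate_biarrs pt \<longleftrightarrow>
    degenerate_bicategory pt B \<and> degenerate_bicategory pt C \<and> weak_functor B C F"
  by (simp add: degenerate_biarrs_def)

lemma bij_betw_xi_obj:
  "bij_betw (xi_obj pt) {B. degenerate_bicategory pt B} {M. monoidal_category M}"
  by (rule bij_betw_byWitness[where f' = "moncat_bicat pt"])
    (auto simp: moncat_bicat_xi_obj xi_obj_moncat_bicat monoidal_category_xi_obj
      degenerate_bicategory_moncat_bicat)

text \<open>Arrows are triples, so inverting the map means recovering source and target as well; the
  object bijection therefore enters in both outer components.\<close>

lemma bij_betw_xi_arr:
  "bij_betw (\<lambda>(B, F, C). (xi_obj pt B, xi_fun pt F, xi_obj pt C)) (degenerate_biarrs pt) monarrs"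
  by (rule bij_betw_byWitness
      [where f' = "\<lambda>(M, F, N). (moncat_bicat pt M, monfun_wfun pt F, moncat_bicat pt N)"])
    (auto simp: degenerate_biarrs_iff monarrs_iff moncat_bicat_xi_obj xi_obj_moncat_bicat
      monfun_wfun_xi_fun xi_fun_monfun_wfun monoidal_functor_xi_fun weak_functor_monfun_wfun
      degenerate_bicategory_moncat_bicat monoidal_functor.axioms(1,2))

theorem theorem4p2:
  fixes pt :: 'z
  shows "equivalence_of_categories
    (Bicat1 pt :: (('z, 'o, 'm) bicat, ('z, 'o, 'm) biarr) cat)
    (MonCat1 :: (('o, 'm) moncat, ('o, 'm) monarr) cat)
    (xi pt)"
proof (rule transported_category.equivalence, intro transported_category.intro
    transported_category_axioms.intro, goal_cases)
  \<comment> \<open>Cases 2 and 3 are the bijections, 9 and 10 concern composition in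
    \<open>Bicat1\<close>, and 11 to 14 say that \<open>xi\<close> respects the structure.
    Extensionality and the closure of \<open>Dom\<close>, \<open>Cod\<close> and \<open>Idt\<close>,
    cases 4 to 8, are left to the closing \<open>auto\<close>.\<close>
  case 1
  then show ?case
    by (rule category_MonCat1)
next
  case 2
  then show ?case
    using bij_betw_xi_obj[of pt] by (simp add: xi_def Bicat1_def MonCat1_def)
next
  case 3
  then show ?case
    using bij_betw_xi_arr[of pt] by (simp add: xi_def Bicat1_def MonCat1_def)
next
  case (9 f g)
  then show ?case
    by (cases f; cases g) (auto simp: Bicat1_def degenerate_biarrs_iff weak_functor_comp_wfun)
next
  case (10 f g)
  then show ?case
    by (cases f; cases g) (auto simp: Bicat1_def)
next
  case (11 f)
  then show ?case
    by (cases f) (auto simp: Bicat1_def MonCat1_def xi_def degenerate_biarrs_iff monarrs_iff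
        monoidal_functor_xi_fun)
next
  case (12 f)
  then show ?case
    by (cases f) (auto simp: Bicat1_def MonCat1_def xi_def degenerate_biarrs_iff monarrs_iff
        monoidal_functor_xi_fun)
next
  case (13 B)
  then show ?case
    by (auto simp: Bicat1_def MonCat1_def xi_def degenerate_biarrs_iff weak_functor_id_wfun
        monoidal_category_xi_obj xi_fun_id_wfun)
next
  case (14 f g)
  then show ?case
    by (cases f; cases g)
      (auto simp: Bicat1_def MonCat1_def xi_def degenerate_biarrs_iff monarrs_iff
        monoidal_functor_xi_fun weak_functor_comp_wfun xi_fun_comp_wfun)
qed (auto simp: Bicat1_def xi_def degenerate_biarrs_iff weak_functor_id_wfun)

end
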